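(* For every positive $\Sigma_2$-computable real number $h$ there exists a surjective computable map $f:\{0,1\}^{\mathbb{N}}\to\{0,1\}^{\mathbb{N}}$ whose topological entropy is $h$.
   Context: A real number $x$ is $\Sigma_2$-computable if there is an algorithm computing a double sequence $(q_{ij})$ of rationals with $x=\sup_i\inf_j q_{ij}$. A function $f:\{0,1\}^{\mathbb{N}}\to\{0,1\}^{\mathbb{N}}$ is computable if there exist a non-decreasing computable function $\varphi:\mathbb{N}\to\mathbb{N}$ and an algorithm which, given $n$ and the first $\varphi(n)$ symbols of a sequence $x$, computes the first $n$ symbols of $f(x)$. Topological entropy of a continuous map $f$ of a compact metric space $X$: for a finite open cover $\mathcal{U}$ of $X$ let $N_n(f,\mathcal{U})$ be the minimal cardinality of a sub-cover of $\bigvee_{0\le k\le n-1}f^{-k}(\mathcal{U})$ (the collection of all intersections $\bigcap_{k=0}^{n-1}f^{-k}(U_k)$, $U_k\in\mathcal{U}$), $h(f,\mathcal{U})=\inf_{n\ge1}\frac{\log_2 N_n(f,\mathcal{U})}{n}$, and $h(f)=\sup_{\mathcal{U}}h(f,\mathcal{U})$. The space $\{0,1\}^{\mathbb{N}}$ carries the product topology. *)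

theory Defs
  imports "HOL-Analysis.Analysis" "HOL-Library.Nat_Bijection"
begin

section \<open>Computable functions on the natural numbers\<close>

text \<open>
  The total recursive functions of Goedel and Kleene serve as the model of computation.
  An \<open>n\<close>-ary function takes its arguments as a list of length \<open>n\<close>; its values on lists
  of any other length are irrelevant, which is what the rule \<open>cong\<close> expresses.  Minimisation is
  restricted to regular functions, so that every function in the class is total.
\<close>

inductive recursive_fun :: "nat \<Rightarrow> (nat list \<Rightarrow> nat) \<Rightarrow> bool" where
  zero: "recursive_fun n (\<lambda>xs. 0)"
| succ: "recursive_fun 1 (\<lambda>xs. Suc (xs ! 0))"
| proj: "i < n \<Longrightarrow> recursive_fun n (\<lambda>xs. xs ! i)"
| comp: "recursive_fun (length gs) f \<Longrightarrow> (\<forall>g\<in>set gs. recursive_fun n g) \<Longrightarrow>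
    recursive_fun n (\<lambda>xs. f (map (\<lambda>g. g xs) gs))"
| prim: "recursive_fun n f \<Longrightarrow> recursive_fun (Suc (Suc n)) g \<Longrightarrow>
    recursive_fun (Suc n)
      (\<lambda>xs. rec_nat (f (tl xs)) (\<lambda>k r. g (k # r # tl xs)) (hd xs))"
| mini: "recursive_fun (Suc n) f \<Longrightarrow> (\<forall>xs. length xs = n \<longrightarrow> (\<exists>y. f (y # xs) = 0)) \<Longrightarrow>
    recursive_fun n (\<lambda>xs. LEAST y. f (y # xs) = 0)"
| cong: "recursive_fun n f \<Longrightarrow> (\<forall>xs. length xs = n \<longrightarrow> g xs = f xs) \<Longrightarrow> recursive_fun n g"

definition computable1 :: "(nat \<Rightarrow> nat) \<Rightarrow> bool" where
  "computable1 f \<longleftrightarrow> recursive_fun 1 (\<lambda>xs. f (xs ! 0))"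

definition computable2 :: "(nat \<Rightarrow> nat \<Rightarrow> nat) \<Rightarrow> bool" where
  "computable2 f \<longleftrightarrow> recursive_fun 2 (\<lambda>xs. f (xs ! 0) (xs ! 1))"


section \<open>\<open>\<Sigma>\<^sub>2\<close>-computable real numbers\<close>

text \<open>A rational is output by computing a sign, a numerator and a positive denominator.\<close>

definition computable_rat_double_seq :: "(nat \<Rightarrow> nat \<Rightarrow> rat) \<Rightarrow> bool" where
  "computable_rat_double_seq q \<longleftrightarrow>
    (\<exists>s a b. computable2 s \<and> computable2 a \<and> computable2 b \<and>
      (\<forall>i j. b i j > 0 \<and> q i j = (- 1) ^ s i j * of_nat (a i j) / of_nat (b i j)))"

text \<open>
  The supremum and infima are taken in the extended reals: an individual infimum may be
  \<open>-\<infinity>\<close>, and on type \<^typ>\<open>real\<close> the operators are unspecified on unbounded sets.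
\<close>

definition Sigma2_computable :: "real \<Rightarrow> bool" where
  "Sigma2_computable x \<longleftrightarrow>
    (\<exists>q. computable_rat_double_seq q \<and>
      ereal x = (SUP i. INF j. ereal (real_of_rat (q i j))))"


section \<open>Computable maps of Cantor space\<close>

text \<open>
  The space of binary sequences is the type \<^typ>\<open>nat \<Rightarrow> bool\<close>; its topology in the class
  \<^class>\<open>topological_space\<close> is the product of the discrete topologies.  Finite words are coded
  as natural numbers by \<^const>\<open>list_encode\<close>.
\<close>

definition word_code :: "(nat \<Rightarrow> bool) \<Rightarrow> nat \<Rightarrow> nat" where
  "word_code x n = list_encode (map (\<lambda>i. of_bool (x i)) [0..<n])"

definition computable_map :: "((nat \<Rightarrow> bool) \<Rightarrow> (nat \<Rightarrow> bool)) \<Rightarrow> bool" where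
  "computable_map f \<longleftrightarrow>
    (\<exists>\<phi> A. mono \<phi> \<and> computable1 \<phi> \<and> computable2 A \<and>
      (\<forall>x n. A n (word_code x (\<phi> n)) = word_code (f x) n))"


section \<open>Topological entropy\<close>

text \<open>
  Only the topology enters the definition, so it is stated for the whole of an arbitrary
  topological space; it is meant for continuous self-maps of compact metrizable spaces.
\<close>

definition finite_open_cover :: "'a::topological_space set set \<Rightarrow> bool" where
  "finite_open_cover \<U> \<longleftrightarrow> finite \<U> \<and> (\<forall>U\<in>\<U>. open U) \<and> \<Union>\<U> = UNIV"

definition cover_join :: "('a \<Rightarrow> 'a) \<Rightarrow> 'a set set \<Rightarrow> nat \<Rightarrow> 'a set set" where
  "cover_join f \<U> n = {(\<Inter>k<n. (f ^^ k) -` U k) | U. \<forall>k<n. U k \<in> \<U>}"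

definition min_subcover_card :: "('a \<Rightarrow> 'a) \<Rightarrow> 'a set set \<Rightarrow> nat \<Rightarrow> nat" where
  "min_subcover_card f \<U> n =
    (LEAST m. \<exists>\<C>. \<C> \<subseteq> cover_join f \<U> n \<and> finite \<C> \<and> \<Union>\<C> = UNIV \<and> card \<C> = m)"

definition cover_entropy :: "('a \<Rightarrow> 'a) \<Rightarrow> 'a set set \<Rightarrow> real" where
  "cover_entropy f \<U> = (INF n\<in>{1..}. log 2 (real (min_subcover_card f \<U> n)) / real n)"

definition topological_entropy :: "('a::topological_space \<Rightarrow> 'a) \<Rightarrow> ereal" where
  "topological_entropy f = (SUP \<U>\<in>{\<U>. finite_open_cover \<U>}. ereal (cover_entropy f \<U>))"

end

theory Submission
  imports Defs
begin

text \<open>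
  Write \<open>h\<close> as the supremum over \<open>i\<close> of the numbers \<open>a\<^sub>i = Inf\<^sub>j q\<^sub>i\<^sub>j\<close>.  It suffices to realise each
  \<open>a\<^sub>i\<close> as an entropy, uniformly in \<open>i\<close>, and to place these systems side by side in Cantor space,
  accumulating at a set on which nothing but a clock moves: the entropy is then the supremum.
  The index \<open>i\<close> is the place of the first one in a selector sequence that never changes.

  The system for one \<open>i\<close> is driven by a clock, the binary odometer, which has entropy zero and visits
  every set of words of length \<open>d\<close> with exactly its frequency.  The clock \<open>c\<close> acts on an infinite deck
  of cards, each holding \<open>K \<ge> h\<close> bits.  It determines a depth \<open>D\<close>, and the top card is inserted at
  depth \<open>D\<close>; if \<open>D\<close> is infinite the top card is lost and the deck is shifted.  Whether \<open>D\<close> exceeds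
  \<open>d\<close> depends only on the first \<open>d\<close> digits of \<open>c\<close>: they must be below \<open>q\<^sub>i\<^sub>j / K\<close> for all \<open>j \<le> d\<close>,
  read as a binary fraction.  So \<open>D\<close> is infinite with frequency \<open>a\<^sub>i / K\<close> (or 0 if \<open>a\<^sub>i\<close> is
  negative), although only approximations from above of \<open>a\<^sub>i\<close> are computable.  The cards are permuted
  or shifted injectively, hence the map is surjective.

  The entropy is \<open>K\<close> times this frequency.  For the upper bound
  (\<open>topological_entropy_shuffle_le\<close>), the first \<open>d\<close> cells along an orbit are determined by their
  initial contents and the cards that enter from below, and a card enters only when \<open>D\<close> is at
  least \<open>d\<close>, which happens with a frequency that tends to \<open>a\<^sub>i / K\<close> as \<open>d\<close> grows.  For the lower bound
  (\<open>le_topological_entropy_shuffle\<close>), a card inserted at depth more than \<open>n\<close> does not return to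
  the top within \<open>n\<close> steps (\<open>origin_top_inject\<close>); hence the number of different cards
  seen on top in \<open>n\<close> steps is at least the number of such insertions.

  Computability (\<open>computable_map_shuffle\<close>) is a matter of writing the map with operations under
  which the recursive functions are closed.
\<close>

section \<open>Closure properties of the recursive functions\<close>

lemma rf_app1:
  assumes "computable1 f" "recursive_fun n a"
  shows "recursive_fun n (\<lambda>xs. f (a xs))"
  using recursive_fun.comp[of "[a]" "\<lambda>ys. f (ys ! 0)" n] assms by (simp add: computable1_def)

lemma rf_app2:
  assumes "computable2 f" "recursive_fun n a" "recursive_fun n b"
  shows "recursive_fun n (\<lambda>xs. f (a xs) (b xs))"
  using recursive_fun.comp[of "[a, b]" "\<lambda>ys. f (ys ! 0) (ys ! 1)" n] assms
  by (simp add: computable2_def numeral_2_eq_2)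

definition computable3 :: "(nat \<Rightarrow> nat \<Rightarrow> nat \<Rightarrow> nat) \<Rightarrow> bool" where
  "computable3 f \<longleftrightarrow> recursive_fun 3 (\<lambda>xs. f (xs ! 0) (xs ! 1) (xs ! 2))"

lemma rf_app3:
  assumes "computable3 f" "recursive_fun n a" "recursive_fun n b" "recursive_fun n c"
  shows "recursive_fun n (\<lambda>xs. f (a xs) (b xs) (c xs))"
  using recursive_fun.comp[of "[a, b, c]" "\<lambda>ys. f (ys ! 0) (ys ! 1) (ys ! 2)" n] assms
  by (simp add: computable3_def numeral_3_eq_3 numeral_2_eq_2)

lemma rf_drop: "m + i < n \<Longrightarrow> recursive_fun n (\<lambda>xs. drop m xs ! i)"
  by (rule recursive_fun.cong[OF recursive_fun.proj[of "m + i" n]]) auto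

text \<open>
  Primitive recursion with parameters: in the step function the list \<open>ys\<close> starts with the
  counter and the value reached so far, and the parameters \<open>xs\<close> are \<open>drop 2 ys\<close>.
\<close>
lemma rf_rec:
  assumes "recursive_fun n c" "recursive_fun n b"
    and "recursive_fun (Suc (Suc n)) (\<lambda>ys. s (ys ! 0) (ys ! 1) (drop 2 ys))"
  shows "recursive_fun n (\<lambda>xs. rec_nat (b xs) (\<lambda>k r. s k r xs) (c xs))"
proof -
  let ?gs = "c # map (\<lambda>i xs. xs ! i) [0..<n]"
  let ?h = "\<lambda>xs. rec_nat (b (tl xs)) (\<lambda>k r. s k r (tl xs)) (hd xs)"
  have "recursive_fun (length ?gs) ?h"
    using recursive_fun.prim[OF assms(2,3)] by (simp add: numeral_2_eq_2)
  then have "recursive_fun n (\<lambda>xs. ?h (map (\<lambda>g. g xs) ?gs))"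
    by (rule recursive_fun.comp) (auto intro: assms recursive_fun.proj)
  then show ?thesis
    by (rule recursive_fun.cong) (auto simp: comp_def map_nth)
qed

lemma rf_least:
  assumes "recursive_fun (Suc n) (\<lambda>ys. of_bool (\<not> P (ys ! 0) (drop 1 ys)))"
    and "\<And>xs. length xs = n \<Longrightarrow> \<exists>y. P y xs"
  shows "recursive_fun n (\<lambda>xs. LEAST y. P y xs)"
  using recursive_fun.mini[OF assms(1)] assms(2) by simp

lemma rf_const: "recursive_fun n (\<lambda>xs. k)"
proof (induction k)
  case (Suc k)
  have "computable1 Suc" by (simp add: computable1_def recursive_fun.succ[unfolded One_nat_def])
  from rf_app1[OF this Suc] show ?case .
qed (rule recursive_fun.zero)

lemma rf_Suc: "recursive_fun n a \<Longrightarrow> recursive_fun n (\<lambda>xs. Suc (a xs))"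
  by (rule rf_app1) (simp_all add: computable1_def recursive_fun.succ[unfolded One_nat_def])

lemma rf_add:
  assumes "recursive_fun n a" "recursive_fun n b"
  shows "recursive_fun n (\<lambda>xs. a xs + b xs)"
proof -
  have "rec_nat x (\<lambda>k r. Suc r) y = x + y" for x y by (induction y) auto
  with rf_rec[OF assms(2,1), of "\<lambda>k r xs. Suc r"] show ?thesis
    by (simp add: rf_Suc recursive_fun.proj)
qed

lemma rf_mult:
  assumes "recursive_fun n a" "recursive_fun n b"
  shows "recursive_fun n (\<lambda>xs. a xs * b xs)"
proof -
  have eq: "rec_nat 0 (\<lambda>k r. r + x) y = x * y" for x y :: nat by (induction y) auto
  have "computable2 (\<lambda>x y. rec_nat 0 (\<lambda>k r. r + x) y)"
    unfolding computable2_def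
    by (rule rf_rec) (rule rf_add rf_drop recursive_fun.proj recursive_fun.zero; simp)+
  from rf_app2[OF this assms] show ?thesis unfolding eq .
qed

lemma rf_diff:
  assumes "recursive_fun n a" "recursive_fun n b"
  shows "recursive_fun n (\<lambda>xs. a xs - b xs)"
proof -
  have eq1: "rec_nat 0 (\<lambda>k r. k) y = y - 1" for y :: nat by (cases y) auto
  have "computable1 (\<lambda>y. rec_nat 0 (\<lambda>k r. k) y)"
    unfolding computable1_def
    by (rule rf_rec) (rule recursive_fun.proj recursive_fun.zero; simp)+
  then have pred: "computable1 (\<lambda>y. y - 1)" by (simp add: eq1)
  have eq: "rec_nat x (\<lambda>k r. r - 1) y = x - y" for x y :: nat by (induction y) auto
  have "computable2 (\<lambda>x y. rec_nat x (\<lambda>k r. r - 1) y)"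
    unfolding computable2_def
    by (rule rf_rec) (rule rf_app1[OF pred] rf_drop recursive_fun.proj recursive_fun.zero; simp)+
  from rf_app2[OF this assms] show ?thesis unfolding eq .
qed

lemma rf_power:
  assumes "recursive_fun n a"
  shows "recursive_fun n (\<lambda>xs. 2 ^ a xs)"
proof -
  have eq: "rec_nat 1 (\<lambda>k r. 2 * r) y = (2 ^ y :: nat)" for y :: nat by (induction y) auto
  have "computable1 (\<lambda>y. rec_nat 1 (\<lambda>k r. 2 * r) y)"
    unfolding computable1_def
    by (rule rf_rec) (rule rf_mult recursive_fun.proj rf_const; simp)+
  from rf_app1[OF this assms] show ?thesis unfolding eq .
qed

lemma rf_not:
  assumes "recursive_fun n (\<lambda>xs. of_bool (P xs))"
  shows "recursive_fun n (\<lambda>xs. of_bool (\<not> P xs))"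
  using rf_diff[OF rf_const[of n 1] assms] by (rule recursive_fun.cong) auto

lemma rf_conj:
  assumes "recursive_fun n (\<lambda>xs. of_bool (P xs))" "recursive_fun n (\<lambda>xs. of_bool (Q xs))"
  shows "recursive_fun n (\<lambda>xs. of_bool (P xs \<and> Q xs))"
  using rf_mult[OF assms] by (rule recursive_fun.cong) auto

lemma rf_le:
  assumes "recursive_fun n a" "recursive_fun n b"
  shows "recursive_fun n (\<lambda>xs. of_bool (a xs \<le> b xs))"
  using rf_diff[OF rf_const[of n 1] rf_diff[OF assms]] by (rule recursive_fun.cong) auto

lemma rf_less:
  assumes "recursive_fun n a" "recursive_fun n b"
  shows "recursive_fun n (\<lambda>xs. of_bool (a xs < b xs))"
  using rf_le[OF rf_Suc[OF assms(1)] assms(2)] by (simp add: Suc_le_eq)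

lemma rf_eq:
  assumes "recursive_fun n a" "recursive_fun n b"
  shows "recursive_fun n (\<lambda>xs. of_bool (a xs = b xs))"
  using rf_conj[OF rf_le[OF assms] rf_le[OF assms(2,1)]] by (simp add: eq_iff)

lemma rf_iff:
  assumes "recursive_fun n (\<lambda>xs. of_bool (P xs))" "recursive_fun n (\<lambda>xs. of_bool (Q xs))"
  shows "recursive_fun n (\<lambda>xs. of_bool (P xs = Q xs))"
  by (rule recursive_fun.cong[OF rf_eq[OF assms]]) auto

lemma rf_if:
  assumes "recursive_fun n (\<lambda>xs. of_bool (P xs))" "recursive_fun n a" "recursive_fun n b"
  shows "recursive_fun n (\<lambda>xs. if P xs then a xs else b xs)"
  using rf_add[OF rf_mult[OF assms(1,2)] rf_mult[OF rf_not[OF assms(1)] assms(3)]]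
  by (rule recursive_fun.cong) auto

lemma rf_if_bool:
  assumes "recursive_fun n (\<lambda>xs. of_bool (P xs))" "recursive_fun n (\<lambda>xs. of_bool (Q xs))"
    "recursive_fun n (\<lambda>xs. of_bool (R xs))"
  shows "recursive_fun n (\<lambda>xs. of_bool (if P xs then Q xs else R xs))"
  using rf_if[OF assms] by (rule recursive_fun.cong) auto

lemma rf_all:
  assumes "recursive_fun n c"
    "recursive_fun (Suc (Suc n)) (\<lambda>ys. of_bool (P (ys ! 0) (drop 2 ys)))"
  shows "recursive_fun n (\<lambda>xs. of_bool (\<forall>j<c xs. P j xs))"
proof -
  have "rec_nat 1 (\<lambda>j r. r * of_bool (P j xs)) m = (of_bool (\<forall>j<m. P j xs) :: nat)" for xs m
    by (induction m) (auto simp: less_Suc_eq)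
  then show ?thesis
    using rf_rec[OF assms(1) rf_const[of n 1], of "\<lambda>j r xs. r * of_bool (P j xs)"]
      rf_mult[OF recursive_fun.proj[of 1 "Suc (Suc n)"] assms(2)]
    by simp
qed

lemma rf_div:
  assumes "recursive_fun n a" "m > 0"
  shows "recursive_fun n (\<lambda>xs. a xs div m)"
proof -
  have ex: "\<exists>y. x < m * Suc y" for x
    by (metis assms(2) dividend_less_times_div mult_Suc_right)
  have eq: "(LEAST y. x < m * Suc y) = x div m" for x
  proof (rule Least_equality)
    show "x < m * Suc (x div m)" using assms(2) by (metis dividend_less_times_div mult_Suc_right)
    show "x div m \<le> y" if "x < m * Suc y" for y
      using less_mult_imp_div_less[of x "Suc y" m] that by (simp add: mult.commute)
  qed
  have "computable1 (\<lambda>x. LEAST y. x < m * Suc y)"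
    unfolding computable1_def using ex
    by (intro rf_least) (intro rf_not rf_less rf_mult rf_Suc rf_const rf_drop recursive_fun.proj; simp)+
  from rf_app1[OF this assms(1)] show ?thesis unfolding eq .
qed

lemma rf_mod:
  assumes "recursive_fun n a" "m > 0"
  shows "recursive_fun n (\<lambda>xs. a xs mod m)"
  using rf_diff[OF assms(1) rf_mult[OF rf_const[of n m] rf_div[OF assms]]]
  by (simp add: minus_mult_div_eq_mod)

lemmas rf_intros = rf_const rf_Suc rf_add rf_mult rf_diff rf_power rf_not rf_conj rf_le rf_less
  rf_eq rf_if rf_if_bool rf_div rf_mod rf_drop recursive_fun.proj

section \<open>Decoding words\<close>

lemma prod_encode_eq_triangle: "prod_encode (a, b) = triangle (a + b) + a"
  by (simp add: prod_encode_def)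

lemma rf_triangle: "recursive_fun n a \<Longrightarrow> recursive_fun n (\<lambda>xs. triangle (a xs))"
  unfolding triangle_def by (intro rf_intros) simp_all

lemma rf_prod_encode:
  "recursive_fun n a \<Longrightarrow> recursive_fun n b \<Longrightarrow> recursive_fun n (\<lambda>xs. prod_encode (a xs, b xs))"
  unfolding prod_encode_eq_triangle by (intro rf_intros rf_triangle)

text \<open>
  The diagonal \<open>a + b\<close> on which the Cantor pairing function places the pair \<open>(a, b)\<close>.  Finding it
  by a search is enough to invert the pairing, because on a fixed diagonal the position is \<open>a\<close>.
\<close>
definition diagonal_of :: "nat \<Rightarrow> nat" where
  "diagonal_of z = (LEAST s. z < triangle (Suc s))"

lemma le_triangle: "k \<le> triangle k"
  by (induction k) auto

lemma triangle_mono: "a \<le> b \<Longrightarrow> triangle a \<le> triangle b"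
  by (induction rule: dec_induct) auto

lemma diagonal_of_prod_encode: "diagonal_of (prod_encode (a, b)) = a + b"
  unfolding diagonal_of_def prod_encode_eq_triangle
proof (rule Least_equality)
  fix s assume "triangle (a + b) + a < triangle (Suc s)"
  then have "\<not> triangle (Suc s) \<le> triangle (a + b)" by simp
  then show "a + b \<le> s" using triangle_mono by (meson not_less_eq_eq)
qed simp

lemma rf_diagonal_of: "recursive_fun n a \<Longrightarrow> recursive_fun n (\<lambda>xs. diagonal_of (a xs))"
proof -
  have ex: "\<exists>s. z < triangle (Suc s)" for z
    using le_triangle[of "Suc z"] by (intro exI[of _ z]) linarith
  have "computable1 diagonal_of"
    unfolding computable1_def diagonal_of_def using ex
    by (intro rf_least) (intro rf_intros rf_triangle; simp)+
  then show "recursive_fun n a \<Longrightarrow> recursive_fun n (\<lambda>xs. diagonal_of (a xs))" by (rule rf_app1)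
qed

definition code_hd :: "nat \<Rightarrow> nat" where
  "code_hd w = (w - 1) - triangle (diagonal_of (w - 1))"

definition code_tl :: "nat \<Rightarrow> nat" where
  "code_tl w = diagonal_of (w - 1) - code_hd w"

lemma code_hd_Cons: "code_hd (list_encode (x # xs)) = x"
  using diagonal_of_prod_encode[of x] by (simp add: code_hd_def prod_encode_eq_triangle)

lemma code_tl_Cons: "code_tl (list_encode (x # xs)) = list_encode xs"
  by (simp add: code_tl_def code_hd_Cons[simplified] diagonal_of_prod_encode)

definition code_nth :: "nat \<Rightarrow> nat \<Rightarrow> nat" where
  "code_nth w j = code_hd ((code_tl ^^ j) w)"

lemma code_nth_list_encode: "j < length xs \<Longrightarrow> code_nth (list_encode xs) j = xs ! j"
proof (induction j arbitrary: xs)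
  case 0
  then show ?case by (cases xs) (auto simp: code_nth_def code_hd_Cons simp del: list_encode.simps)
next
  case (Suc j)
  then obtain y ys where xs: "xs = y # ys" by (cases xs) auto
  have "(code_tl ^^ Suc j) (list_encode xs) = (code_tl ^^ j) (list_encode ys)"
    by (simp add: funpow_Suc_right xs code_tl_Cons del: funpow.simps list_encode.simps)
  with Suc show ?case by (simp add: code_nth_def xs del: funpow.simps list_encode.simps)
qed

lemma rf_code_hd: "recursive_fun n a \<Longrightarrow> recursive_fun n (\<lambda>xs. code_hd (a xs))"
  unfolding code_hd_def by (intro rf_intros rf_triangle rf_diagonal_of)

lemma rf_code_tl: "recursive_fun n a \<Longrightarrow> recursive_fun n (\<lambda>xs. code_tl (a xs))"
  unfolding code_tl_def by (intro rf_intros rf_code_hd rf_diagonal_of)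

lemma rf_code_nth:
  assumes "recursive_fun n a" "recursive_fun n b"
  shows "recursive_fun n (\<lambda>xs. code_nth (a xs) (b xs))"
proof -
  have "rec_nat w (\<lambda>k r. code_tl r) j = (code_tl ^^ j) w" for w j by (induction j) auto
  then have "computable2 (\<lambda>w j. code_nth w j)"
    unfolding computable2_def code_nth_def
    using rf_rec[of 2 "\<lambda>xs. xs ! 1" "\<lambda>xs. xs ! 0" "\<lambda>k r xs. code_tl r"]
    by (intro rf_code_hd) (simp add: rf_code_tl recursive_fun.proj)
  from rf_app2[OF this assms] show ?thesis .
qed

lemma computable2_encode_prefix:
  assumes "computable2 (\<lambda>w k. of_bool (p w k))"
  shows "computable2 (\<lambda>n w. word_code (p w) n)"
proof -
  (* The code of a word is built from its last symbol backwards, since the coding of lists adds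
     elements in front. *)
  have suffix: "rec_nat 0 (\<lambda>k r. Suc (prod_encode (of_bool (p w (n - Suc k)), r))) m
      = list_encode (map (\<lambda>i. of_bool (p w i)) [n - m..<n])" if "m \<le> n" for w n m
    using that
  proof (induction m)
    case (Suc m)
    then have "[n - Suc m..<n] = (n - Suc m) # [n - m..<n]"
      by (metis Suc_diff_Suc Suc_le_lessD diff_less upt_rec zero_less_Suc zero_less_iff_neq_zero not_less0)
    with Suc show ?case by simp
  qed simp
  have "computable2 (\<lambda>n w. rec_nat 0 (\<lambda>k r. Suc (prod_encode (of_bool (p w (n - Suc k)), r))) n)"
    unfolding computable2_def
    by (rule rf_rec)
      (intro rf_intros rf_prod_encode rf_app2[OF assms, where n="Suc (Suc 2)"]; simp)+
  then show ?thesis by (simp add: suffix word_code_def)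
qed

section \<open>The topology of Cantor space\<close>

lemma open_cylinder: "open {y :: nat \<Rightarrow> bool. \<forall>k<m. y k = z k}"
proof -
  have "{y :: nat \<Rightarrow> bool. \<forall>k<m. y k = z k} = Pi\<^sub>E UNIV (\<lambda>k. if k < m then {z k} else UNIV)"
    by (auto simp: PiE_iff split: if_splits)
  also have "open \<dots>"
    by (rule open_PiE) (auto simp: open_discrete intro: finite_subset[of _ "{..<m}"] split: if_splits)
  finally show ?thesis .
qed

lemma open_finitely_determined:
  assumes "\<And>y z :: nat \<Rightarrow> bool. \<forall>k<m. y k = z k \<Longrightarrow> y \<in> A \<Longrightarrow> z \<in> A"
  shows "open A"
proof -
  have "y \<in> A" if "z \<in> A" "\<forall>k<m. y k = z k" for y z
    using assms[of z y] that by simp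
  then have "A = (\<Union>z\<in>A. {y. \<forall>k<m. y k = z k})"
    by blast
  also have "open \<dots>" by (intro open_UN ballI open_cylinder)
  finally show ?thesis .
qed

lemma cylinder_subset_open:
  assumes "open U" "z \<in> U"
  shows "\<exists>m. {y :: nat \<Rightarrow> bool. \<forall>k<m. y k = z k} \<subseteq> U"
proof -
  from product_topology_open_contains_basis[of "\<lambda>_. euclidean" UNIV U z] assms
  obtain X where X: "z \<in> Pi\<^sub>E UNIV X" "finite {i. X i \<noteq> UNIV}" "Pi\<^sub>E UNIV X \<subseteq> U"
    by (auto simp: open_fun_def)
  from finite_nat_bounded[OF X(2)] obtain m where m: "{i. X i \<noteq> UNIV} \<subseteq> {..<m}"
    by blast
  have "y \<in> Pi\<^sub>E UNIV X" if "\<forall>k<m. y k = z k" for y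
  proof (rule PiE_I)
    fix i
    show "y i \<in> X i"
    proof (cases "X i = UNIV")
      case False
      with m have "i < m" by auto
      with that X(1) show ?thesis by (auto simp: PiE_iff)
    qed simp
  qed auto
  with X(3) show ?thesis by blast
qed

lemma compact_Cantor: "compact (UNIV :: (nat \<Rightarrow> bool) set)"
proof -
  have "compact (UNIV :: bool set)" by (simp add: finite_imp_compact)
  then have "compact_space (euclidean :: bool topology)"
    by (simp add: compact_space_def compactin_euclidean_iff)
  then have "compact_space (product_topology (\<lambda>_ :: nat. euclidean :: bool topology) UNIV)"
    by (simp add: compact_space_product_topology)
  then show ?thesis
    by (simp add: euclidean_product_topology compact_space_def compactin_euclidean_iff)
qed

lemma finite_open_cover_cylinders:
  assumes "finite_open_cover \<U>"
  obtains m where "\<And>z :: nat \<Rightarrow> bool. \<exists>U\<in>\<U>. {y. \<forall>k<m. y k = z k} \<subseteq> U"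
proof -
  have "\<exists>l. \<exists>U\<in>\<U>. {y. \<forall>k<l. y k = z k} \<subseteq> U" for z
  proof -
    from assms have "z \<in> \<Union>\<U>" by (simp add: finite_open_cover_def)
    then obtain U where U: "U \<in> \<U>" "z \<in> U" by (rule UnionE)
    with assms have "open U" by (simp add: finite_open_cover_def)
    from cylinder_subset_open[OF this U(2)] U(1) show ?thesis by blast
  qed
  then have "\<forall>z. \<exists>l. \<exists>U\<in>\<U>. {y. \<forall>k<l. y k = z k} \<subseteq> U" ..
  from choice[OF this] obtain l where "\<forall>z. \<exists>U\<in>\<U>. {y. \<forall>k<l z. y k = z k} \<subseteq> U" ..
  then have l: "\<exists>U\<in>\<U>. {y. \<forall>k<l z. y k = z k} \<subseteq> U" for z ..
  obtain D where D: "finite D" "UNIV \<subseteq> (\<Union>z\<in>D. {y :: nat \<Rightarrow> bool. \<forall>k<l z. y k = z k})"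
    by (rule compactE_image[OF compact_Cantor, of UNIV "\<lambda>z. {y. \<forall>k<l z. y k = z k}"])
      (auto intro: open_cylinder)
  show thesis
  proof
    fix z :: "nat \<Rightarrow> bool"
    have "z \<in> (\<Union>a\<in>D. {y. \<forall>k<l a. y k = a k})" using D(2) UNIV_I by (rule subsetD)
    then obtain a where a: "a \<in> D" "\<forall>k<l a. z k = a k" by auto
    have "l a \<le> Max (l ` D)" using D(1) a(1) by (intro Max_ge) simp_all
    then have sub: "{y. \<forall>k<Max (l ` D). y k = z k} \<subseteq> {y. \<forall>k<l a. y k = a k}"
      using a(2) by (intro Collect_mono impI allI) (metis order_less_le_trans)
    from l[of a] obtain U where "U \<in> \<U>" "{y. \<forall>k<l a. y k = a k} \<subseteq> U" ..
    with sub show "\<exists>U\<in>\<U>. {y. \<forall>k<Max (l ` D). y k = z k} \<subseteq> U"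
      by (intro bexI[of _ U]) (rule subset_trans)
  qed
qed

section \<open>Counting subcovers\<close>

text \<open>
  Each class of points with the same key lies in one member of the join, so the number of keys
  bounds the size of a smallest subcover.
\<close>
lemma min_subcover_card_le:
  assumes "finite (range key)"
    and "\<And>z t. t < n \<Longrightarrow> \<exists>U\<in>\<U>. \<forall>y. key y = key z \<longrightarrow> (f ^^ t) y \<in> U"
  shows "min_subcover_card f \<U> n \<le> card (range key)"
proof -
  let ?a = "\<lambda>w. SOME z. key z = w"
  have a: "key (?a (key z)) = key z" for z by (rule someI) simp
  define V where "V z t = (SOME U. U \<in> \<U> \<and> (\<forall>y. key y = key z \<longrightarrow> (f ^^ t) y \<in> U))" for z t
  have V': "V z t \<in> \<U> \<and> (\<forall>y. key y = key z \<longrightarrow> (f ^^ t) y \<in> V z t)" if "t < n" for z t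
    unfolding V_def by (rule someI_ex) (use assms(2)[OF that, of z] in blast)
  then have V: "V z t \<in> \<U>" "key y = key z \<Longrightarrow> (f ^^ t) y \<in> V z t" if "t < n" for z t y
    using that by blast+
  let ?\<C> = "(\<lambda>w. \<Inter>t<n. (f ^^ t) -` V (?a w) t) ` range key"
  have "?\<C> \<subseteq> cover_join f \<U> n" using V(1) unfolding cover_join_def by blast
  moreover have "z \<in> \<Union>?\<C>" for z
    using V(2)[of _ z "?a (key z)"] a[of z] by auto
  then have "\<Union>?\<C> = UNIV" by blast
  ultimately have "min_subcover_card f \<U> n \<le> card ?\<C>"
    unfolding min_subcover_card_def using assms(1) by (intro Least_le) blast
  also have "\<dots> \<le> card (range key)" using assms(1) by (rule card_image_le)
  finally show ?thesis .
qed

lemma finite_cover_join: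
  assumes "finite \<U>"
  shows "finite (cover_join f \<U> n)"
proof -
  have "cover_join f \<U> n \<subseteq> (\<lambda>V. \<Inter>k<n. (f ^^ k) -` V k) ` Pi\<^sub>E {..<n} (\<lambda>_. \<U>)"
  proof
    fix C assume "C \<in> cover_join f \<U> n"
    then obtain V where "\<forall>k<n. V k \<in> \<U>" "C = (\<Inter>k<n. (f ^^ k) -` V k)"
      by (auto simp: cover_join_def)
    then show "C \<in> (\<lambda>V. \<Inter>k<n. (f ^^ k) -` V k) ` Pi\<^sub>E {..<n} (\<lambda>_. \<U>)"
      by (intro image_eqI[of _ _ "restrict V {..<n}"]) auto
  qed
  then show ?thesis by (rule finite_subset) (intro finite_imageI finite_PiE finite_lessThan assms)
qed

text \<open>
  Two points that some iterate sends into no common member of the cover cannot share a member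
  of the join, so a subcover needs a member of its own for every point of a separated set.
\<close>
lemma card_separated_le_min_subcover_card:
  assumes "finite \<U>" "\<Union>\<U> = UNIV"
    and "\<And>y z. y \<in> Z \<Longrightarrow> z \<in> Z \<Longrightarrow> y \<noteq> z \<Longrightarrow>
      \<exists>t<n. \<forall>U\<in>\<U>. (f ^^ t) y \<in> U \<longrightarrow> (f ^^ t) z \<notin> U"
  shows "card Z \<le> min_subcover_card f \<U> n"
proof -
  have "\<exists>C\<in>cover_join f \<U> n. z \<in> C" for z
  proof -
    have ex: "\<exists>U. U \<in> \<U> \<and> y \<in> U" for y
      using UNIV_I[of y] unfolding assms(2)[symmetric] by blast
    define V where "V k = (SOME U. U \<in> \<U> \<and> (f ^^ k) z \<in> U)" for k
    have V: "V k \<in> \<U>" "(f ^^ k) z \<in> V k" for k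
      using someI_ex[OF ex[of "(f ^^ k) z"]] by (simp_all add: V_def)
    then have "(\<Inter>k<n. (f ^^ k) -` V k) \<in> cover_join f \<U> n"
      unfolding cover_join_def by (intro CollectI exI[of _ V]) simp
    moreover have "z \<in> (\<Inter>k<n. (f ^^ k) -` V k)" using V by simp
    ultimately show ?thesis by (rule rev_bexI)
  qed
  then have "\<Union>(cover_join f \<U> n) = UNIV" by (simp add: set_eq_iff)
  then have "\<exists>m \<C>. \<C> \<subseteq> cover_join f \<U> n \<and> finite \<C> \<and> \<Union>\<C> = UNIV \<and> card \<C> = m"
    using finite_cover_join[OF assms(1), of f n] by (metis order_refl)
  then have "\<exists>\<C>. \<C> \<subseteq> cover_join f \<U> n \<and> finite \<C> \<and> \<Union>\<C> = UNIV \<and>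
      card \<C> = min_subcover_card f \<U> n"
    unfolding min_subcover_card_def by (rule LeastI_ex)
  then obtain \<C> where \<C>: "\<C> \<subseteq> cover_join f \<U> n" "finite \<C>" "\<Union>\<C> = UNIV"
      "card \<C> = min_subcover_card f \<U> n"
    by blast
  have "\<exists>C. C \<in> \<C> \<and> z \<in> C" for z
    using UNIV_I[of z] unfolding \<C>(3)[symmetric] by blast
  then have "\<forall>z. \<exists>C. C \<in> \<C> \<and> z \<in> C" ..
  from choice[OF this] obtain c where "\<forall>z. c z \<in> \<C> \<and> z \<in> c z" ..
  then have c: "c z \<in> \<C>" "z \<in> c z" for z by simp_all
  have "inj_on c Z"
  proof (rule inj_onI, rule ccontr)
    fix y z assume yz: "y \<in> Z" "z \<in> Z" "c y = c z" "y \<noteq> z"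
    then obtain t where t: "t < n" "\<forall>U\<in>\<U>. (f ^^ t) y \<in> U \<longrightarrow> (f ^^ t) z \<notin> U"
      using assms(3)[OF yz(1,2,4)] by (elim exE conjE)
    have "c y \<in> cover_join f \<U> n" using c(1)[of y] \<C>(1) by (rule rev_subsetD)
    then obtain V where V: "\<forall>k<n. V k \<in> \<U>" "c y = (\<Inter>k<n. (f ^^ k) -` V k)"
      unfolding cover_join_def mem_Collect_eq by (elim exE conjE)
    then have "(f ^^ t) y \<in> V t" "(f ^^ t) z \<in> V t" "V t \<in> \<U>"
      using c(2)[of y] c(2)[of z] yz(3) t(1) by auto
    with t(2) show False by blast
  qed
  then have "card Z = card (c ` Z)" by (simp add: card_image)
  also have "\<dots> \<le> card \<C>" using c(1) by (intro card_mono \<C>(2)) auto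
  finally show ?thesis using \<C>(4) by simp
qed

lemma cover_entropy_le:
  fixes f :: "'a \<Rightarrow> 'a"
  assumes "finite \<U>" "\<Union>\<U> = UNIV" "n \<ge> 1" "min_subcover_card f \<U> n \<le> 2 ^ b"
  shows "cover_entropy f \<U> \<le> real b / real n"
proof -
  have pos: "min_subcover_card f \<U> n \<ge> 1" for n
    using card_separated_le_min_subcover_card[OF assms(1,2), of "{undefined}"] by simp
  have "cover_entropy f \<U> \<le> log 2 (real (min_subcover_card f \<U> n)) / real n"
    unfolding cover_entropy_def
  proof (rule cINF_lower)
    show "bdd_below ((\<lambda>n. log 2 (real (min_subcover_card f \<U> n)) / real n) ` {1..})"
      using pos by (intro bdd_belowI2[of _ 0] divide_nonneg_nonneg)
        (simp_all add: zero_le_log_cancel_iff Suc_le_eq)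
  qed (use assms in auto)
  moreover have "log 2 (real (min_subcover_card f \<U> n)) \<le> log 2 (real (2 ^ b))"
    using pos[of n] assms(4) by (intro log_mono) (auto simp del: of_nat_power)
  then have "log 2 (real (min_subcover_card f \<U> n)) / real n \<le> real b / real n"
    by (intro divide_right_mono) (simp_all add: log_nat_power)
  ultimately show ?thesis by simp
qed

lemma le_cover_entropy:
  assumes "\<And>n. n \<ge> 1 \<Longrightarrow> \<exists>b. 2 ^ b \<le> min_subcover_card f \<U> n \<and> y * real n \<le> real b"
  shows "y \<le> cover_entropy f \<U>"
  unfolding cover_entropy_def
proof (rule cINF_greatest)
  fix n :: nat assume "n \<in> {1..}"
  then have n: "n \<ge> 1" by simp
  from assms[OF n] obtain b where b: "2 ^ b \<le> min_subcover_card f \<U> n" "y * real n \<le> real b" by blast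
  have "real b = log 2 (real (2 ^ b))" by (simp add: log_nat_power)
  also have "\<dots> \<le> log 2 (real (min_subcover_card f \<U> n))"
    using b(1) by (intro log_mono) (simp_all only: of_nat_le_iff, simp_all)
  finally show "y \<le> log 2 (real (min_subcover_card f \<U> n)) / real n"
    using b(2) n by (simp add: pos_le_divide_eq)
qed simp

section \<open>The odometer\<close>

text \<open>
  Adding one to a 2-adic integer whose lowest digit comes first: a digit is flipped exactly when
  the carry has passed through all the digits before it.
\<close>
definition odometer :: "(nat \<Rightarrow> bool) \<Rightarrow> nat \<Rightarrow> bool" where
  "odometer c k \<longleftrightarrow> c k \<noteq> (\<forall>b<k. c b)"

lemma odometer_cong: "(\<And>b. b \<le> k \<Longrightarrow> c b = c' b) \<Longrightarrow> odometer c k = odometer c' k"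
  by (simp add: odometer_def)

text \<open>
  The first \<open>d\<close> digits are read in two ways.  With the first digit as the most significant one,
  \<open>prefix_value c d / 2 ^ d\<close> approximates from below the real number with binary expansion \<open>c\<close>,
  so thresholds on it define nested sets of prefixes.  With the first digit as the least significant
  one, the odometer acts on the value as addition of one modulo \<open>2 ^ d\<close>.
\<close>
primrec prefix_value :: "(nat \<Rightarrow> bool) \<Rightarrow> nat \<Rightarrow> nat" where
  "prefix_value c 0 = 0"
| "prefix_value c (Suc d) = 2 * prefix_value c d + of_bool (c d)"

primrec counter_value :: "(nat \<Rightarrow> bool) \<Rightarrow> nat \<Rightarrow> nat" where
  "counter_value c 0 = 0"
| "counter_value c (Suc d) = counter_value c d + of_bool (c d) * 2 ^ d"

lemma prefix_value_less: "prefix_value c d < 2 ^ d"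
  by (induction d) auto

lemma prefix_value_div2: "prefix_value c (Suc d) div 2 = prefix_value c d"
  by simp

lemma prefix_value_eq_iff:
  "prefix_value c d = prefix_value c' d \<longleftrightarrow> (\<forall>b<d. c b = c' b)"
proof (induction d)
  case (Suc d)
  have step: "2 * a + of_bool p = 2 * b + of_bool q \<longleftrightarrow> a = b \<and> p = q" for a b :: nat and p q
    by (cases p; cases q; simp; presburger)
  show ?case unfolding prefix_value.simps step All_less_Suc Suc by (rule conj_commute)
qed simp

lemma prefix_value_cong: "(\<And>b. b < d \<Longrightarrow> c b = c' b) \<Longrightarrow> prefix_value c d = prefix_value c' d"
  by (simp add: prefix_value_eq_iff)

lemma counter_value_cong: "(\<And>b. b < d \<Longrightarrow> c b = c' b) \<Longrightarrow> counter_value c d = counter_value c' d"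
  by (induction d) auto

lemma counter_value_less: "counter_value c d < 2 ^ d"
  by (induction d) auto

lemma Suc_counter_value_eq_iff: "Suc (counter_value c d) = 2 ^ d \<longleftrightarrow> (\<forall>b<d. c b)"
proof (induction d)
  case (Suc d)
  then show ?case using counter_value_less[of c d] by (auto simp: less_Suc_eq)
qed simp

lemma counter_value_odometer: "counter_value (odometer c) d = Suc (counter_value c d) mod 2 ^ d"
proof (induction d)
  case (Suc d)
  show ?case
  proof (cases "\<forall>b<d. c b")
    case True
    then have one: "Suc (counter_value c d) = 2 ^ d" by (simp add: Suc_counter_value_eq_iff)
    have d: "odometer c d \<longleftrightarrow> \<not> c d" using True by (auto simp: odometer_def)
    show ?thesis
    proof (cases "c d")
      case True
      then have "Suc (counter_value c (Suc d)) = 2 ^ Suc d" using one by simp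
      with True d Suc one show ?thesis by (simp del: power_Suc)
    next
      case False
      with d Suc one show ?thesis by simp
    qed
  next
    case False
    then have "Suc (counter_value c d) < 2 ^ d"
      using counter_value_less[of c d] Suc_counter_value_eq_iff[of c d] by (metis Suc_lessI)
    with Suc False show ?thesis by (auto simp: odometer_def)
  qed
qed simp

lemma counter_value_odometer_funpow:
  "counter_value ((odometer ^^ t) c) d = (counter_value c d + t) mod 2 ^ d"
  by (induction t) (auto simp: counter_value_odometer counter_value_less mod_Suc_eq)

lemma add_mod_left_inject:
  fixes a b v N :: nat
  assumes "(v + a) mod N = (v + b) mod N" "a < N" "b < N"
  shows "a = b"
proof -
  have le: "b \<le> a" if "(v + a) mod N = (v + b) mod N" "b < N" for a b
  proof (rule ccontr)
    assume "\<not> b \<le> a"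
    then have "N dvd (v + b) - (v + a)"
      using mod_eq_dvd_iff_nat[of "v + a" "v + b" N] that(1) by simp
    then have "N dvd b - a" by simp
    then show False using \<open>\<not> b \<le> a\<close> that(2) by (meson nat_dvd_not_less less_imp_diff_less not_le zero_less_diff)
  qed
  from le[OF assms(1,3)] le[OF assms(1)[symmetric] assms(2)] show ?thesis by simp
qed

text \<open>
  The counter value takes every residue modulo \<open>2 ^ d\<close> once in \<open>2 ^ d\<close> steps, and both values
  determine the same \<open>d\<close> digits.  Hence every clock visits a set of prefixes exactly as often
  in \<open>2 ^ d\<close> steps as the size of the set; both entropy bounds rest on this.
\<close>
lemma bij_betw_prefix_value_odometer:
  "bij_betw (\<lambda>t. prefix_value ((odometer ^^ t) c) d) {..<2 ^ d} {..<2 ^ d}"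
proof -
  have inj: "inj_on (\<lambda>t. prefix_value ((odometer ^^ t) c) d) {..<2 ^ d}"
  proof (rule inj_onI)
    fix s t :: nat
    assume st: "s \<in> {..<2 ^ d}" "t \<in> {..<2 ^ d}"
      and eq: "prefix_value ((odometer ^^ s) c) d = prefix_value ((odometer ^^ t) c) d"
    from eq have "counter_value ((odometer ^^ s) c) d = counter_value ((odometer ^^ t) c) d"
      unfolding prefix_value_eq_iff by (intro counter_value_cong) (erule allE, erule (1) mp)
    then have "(counter_value c d + s) mod 2 ^ d = (counter_value c d + t) mod 2 ^ d"
      by (simp add: counter_value_odometer_funpow)
    with st show "s = t" using add_mod_left_inject unfolding lessThan_iff by meson
  qed
  moreover have "(\<lambda>t. prefix_value ((odometer ^^ t) c) d) ` {..<2 ^ d} = {..<2 ^ d}"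
    by (rule card_subset_eq) (auto simp: prefix_value_less card_image[OF inj])
  ultimately show ?thesis by (rule bij_betw_imageI)
qed

lemma sum_prefix_value_odometer:
  "(\<Sum>t<2 ^ d. g (prefix_value ((odometer ^^ t) c) d)) = (\<Sum>R<2 ^ d. g R :: nat)"
  using bij_betw_prefix_value_odometer by (rule sum.reindex_bij_betw)

lemma sum_prefix_value_odometer_multiple:
  "(\<Sum>t<s * 2 ^ d. g (prefix_value ((odometer ^^ t) c) d)) = s * (\<Sum>R<2 ^ d. g R :: nat)"
proof -
  let ?h = "\<lambda>t. g (prefix_value ((odometer ^^ t) c) d)"
  have "sum ?h {m * 2 ^ d..<m * 2 ^ d + 2 ^ d} = (\<Sum>R<2 ^ d. g R)" for m
  proof -
    have "sum ?h {m * 2 ^ d..<m * 2 ^ d + 2 ^ d} = (\<Sum>t<2 ^ d. ?h (t + m * 2 ^ d))"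
      using sum.shift_bounds_nat_ivl[of ?h 0 "m * 2 ^ d" "2 ^ d"]
      by (simp add: add.commute atLeast0LessThan)
    also have "\<dots> = (\<Sum>t<2 ^ d. g (prefix_value ((odometer ^^ t) ((odometer ^^ (m * 2 ^ d)) c)) d))"
      by (simp add: funpow_add)
    finally show ?thesis by (simp add: sum_prefix_value_odometer)
  qed
  then show ?thesis using sum.nat_group[of ?h "2 ^ d" s] by simp
qed

text \<open>
  Summed over all \<open>2 ^ d\<close> starting times, the visits in a window of length \<open>n\<close> number \<open>n\<close> times
  the total of \<open>g\<close>; so some window is at least average.
\<close>
lemma odometer_window_above_average:
  obtains s where
    "n * (\<Sum>R<2 ^ d. g R :: nat) \<le> 2 ^ d * (\<Sum>t<n. g (prefix_value ((odometer ^^ (t + s)) c) d))"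
proof (rule ccontr)
  let ?S = "\<Sum>R<2 ^ d. g R" and ?W = "\<lambda>s. \<Sum>t<n. g (prefix_value ((odometer ^^ (t + s)) c) d)"
  assume "\<not> thesis"
  then have less: "2 ^ d * ?W s < n * ?S" for s using that[of s] by force
  have "(\<Sum>s<2 ^ d. ?W s) = (\<Sum>t<n. \<Sum>s<2 ^ d. g (prefix_value ((odometer ^^ (t + s)) c) d))"
    by (rule sum.swap)
  also have "\<dots> = (\<Sum>t<n. \<Sum>s<2 ^ d. g (prefix_value ((odometer ^^ s) ((odometer ^^ t) c)) d))"
    by (subst add.commute) (simp add: funpow_add)
  also have "\<dots> = n * ?S" by (simp add: sum_prefix_value_odometer)
  finally have "2 ^ d * (n * ?S) = 2 ^ d * (\<Sum>s<2 ^ d. ?W s)" by simp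
  also have "\<dots> = (\<Sum>s<2 ^ d. 2 ^ d * ?W s)" by (rule sum_distrib_left)
  also have "\<dots> < (\<Sum>s<(2::nat) ^ d. n * ?S)"
    by (intro sum_strict_mono less) (simp_all add: lessThan_empty_iff bot_nat_def)
  finally show False by simp
qed

lemma surj_odometer: "surj odometer"
  unfolding surj_def
proof
  fix c :: "nat \<Rightarrow> bool"
  (* Subtracting one: a digit is flipped exactly when all the digits before it are zero. *)
  let ?p = "\<lambda>k. c k \<noteq> (\<forall>b<k. \<not> c b)"
  have "(\<forall>b<k. ?p b) \<longleftrightarrow> (\<forall>b<k. \<not> c b)" for k
  proof (induction k)
    case (Suc k)
    then show ?case unfolding All_less_Suc by blast
  qed simp
  then have "c k = odometer ?p k" for k
    unfolding odometer_def by (cases "\<forall>b<k. \<not> c b") simp_all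
  then have "c = odometer ?p" by (rule ext)
  then show "\<exists>p. c = odometer p" by (intro exI[of _ ?p])
qed

section \<open>Three tracks in one binary sequence\<close>

primrec leading_zeros :: "(nat \<Rightarrow> bool) \<Rightarrow> nat \<Rightarrow> nat" where
  "leading_zeros u 0 = 0"
| "leading_zeros u (Suc n) =
    (if leading_zeros u n = n \<and> \<not> u n then Suc n else leading_zeros u n)"

lemma leading_zeros_cong: "(\<And>b. b < d \<Longrightarrow> u b = u' b) \<Longrightarrow> leading_zeros u d = leading_zeros u' d"
  by (induction d) auto

definition first_one :: "(nat \<Rightarrow> bool) \<Rightarrow> nat \<Rightarrow> bool" where
  "first_one u i \<longleftrightarrow> u i \<and> (\<forall>j<i. \<not> u j)"

lemma first_one_cases:
  obtains "\<And>j. \<not> u j" | i where "first_one u i"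
  using LeastI_ex[of u] not_less_Least[of _ u] unfolding first_one_def by blast

lemma leading_zeros_eq_min:
  assumes "first_one u i"
  shows "leading_zeros u n = min i n"
proof (induction n)
  case (Suc n)
  show ?case
  proof (cases i n rule: linorder_cases)
    case equal
    with Suc assms show ?thesis by (simp add: first_one_def)
  next
    case greater
    with assms have "\<not> u n" by (simp add: first_one_def)
    with Suc greater show ?thesis by simp
  qed (use Suc in simp)
qed simp

lemma leading_zeros_eq_self: "(\<And>j. j < n \<Longrightarrow> \<not> u j) \<Longrightarrow> leading_zeros u n = n"
  by (induction n) auto

lemma leading_zeros_le: "leading_zeros u n \<le> n"
  by (induction n) auto

text \<open>
  A sequence carries a selector, a clock and a deck of cards on the residue classes modulo 3.
\<close>
definition selector :: "(nat \<Rightarrow> bool) \<Rightarrow> nat \<Rightarrow> bool" where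
  "selector z j = z (3 * j)"

definition clock :: "(nat \<Rightarrow> bool) \<Rightarrow> nat \<Rightarrow> bool" where
  "clock z j = z (3 * j + 1)"

definition deck :: "(nat \<Rightarrow> bool) \<Rightarrow> nat \<Rightarrow> bool" where
  "deck z j = z (3 * j + 2)"

definition join_tracks :: "(nat \<Rightarrow> bool) \<Rightarrow> (nat \<Rightarrow> bool) \<Rightarrow> (nat \<Rightarrow> bool) \<Rightarrow> nat \<Rightarrow> bool" where
  "join_tracks u c x n =
    (if n mod 3 = 0 then u (n div 3) else if n mod 3 = 1 then c (n div 3) else x (n div 3))"

lemma tracks_join [simp]:
  "selector (join_tracks u c x) = u" "clock (join_tracks u c x) = c" "deck (join_tracks u c x) = x"
proof -
  have "(3 * j + 1) mod 3 = 1" "(3 * j + 1) div 3 = j" "(3 * j + 2) mod 3 = 2" "(3 * j + 2) div 3 = j"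
    for j :: nat by presburger+
  then have "selector (join_tracks u c x) j = u j" "clock (join_tracks u c x) j = c j"
      "deck (join_tracks u c x) j = x j" for j
    unfolding selector_def clock_def deck_def join_tracks_def by simp_all
  then show "selector (join_tracks u c x) = u" "clock (join_tracks u c x) = c"
      "deck (join_tracks u c x) = x" by (intro ext; simp)+
qed

lemma join_tracks_split: "join_tracks (selector z) (clock z) (deck z) = z"
proof
  fix n :: nat
  have "n = 3 * (n div 3) \<or> n = 3 * (n div 3) + 1 \<or> n = 3 * (n div 3) + 2" by presburger
  then obtain q where q: "n = 3 * q \<or> n = 3 * q + 1 \<or> n = 3 * q + 2" by blast
  have "(3 * q + 1) mod 3 = 1" "(3 * q + 1) div 3 = q" "(3 * q + 2) mod 3 = 2" "(3 * q + 2) div 3 = q"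
    by presburger+
  with q show "join_tracks (selector z) (clock z) (deck z) n = z n"
    unfolding selector_def clock_def deck_def join_tracks_def by (elim disjE) simp_all
qed

section \<open>The shuffle\<close>

text \<open>
  A cell of the deck holds a card of \<open>K\<close> bits.  If the first one of the selector is at place \<open>i\<close>,
  the cards above cell \<open>i\<close> never move and the top of the moving deck is cell \<open>i\<close>.  The predicate
  \<open>G i d R\<close> says whether a clock with prefix value \<open>R\<close> moves the card in cell \<open>d + 1\<close> up to
  cell \<open>d\<close>; the nesting assumption makes the set of such cells an initial segment of the moving deck,
  possibly empty or infinite.  When it is finite, the top card goes to the first cell of the moving
  deck after this segment.
  
  Keeping the cells above \<open>i\<close> at rest makes the map continuous at the sequences whose selector is
  zero, where no deck moves, without any uniformity of \<open>G\<close> in \<open>i\<close>.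
\<close>
locale card_insertion =
  fixes K :: nat and G :: "nat \<Rightarrow> nat \<Rightarrow> nat \<Rightarrow> bool"
  assumes K_pos: "K > 0"
    and nested: "G i (Suc d) R \<Longrightarrow> G i d (R div 2)"
begin

definition active :: "(nat \<Rightarrow> bool) \<Rightarrow> (nat \<Rightarrow> bool) \<Rightarrow> nat \<Rightarrow> bool" where
  "active u c d \<longleftrightarrow> leading_zeros u (Suc d) \<le> d \<and> G (leading_zeros u (Suc d)) d (prefix_value c d)"

definition source :: "(nat \<Rightarrow> bool) \<Rightarrow> (nat \<Rightarrow> bool) \<Rightarrow> nat \<Rightarrow> nat" where
  "source u c d =
    (if active u c d then Suc d else if d > 0 \<and> active u c (d - 1) then leading_zeros u d else d)"

definition shuffle :: "(nat \<Rightarrow> bool) \<Rightarrow> nat \<Rightarrow> bool" where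
  "shuffle z = join_tracks (selector z) (odometer (clock z))
    (\<lambda>k. deck z (K * source (selector z) (clock z) (k div K) + k mod K))"

lemma active_cong:
  "(\<And>j. j \<le> d \<Longrightarrow> u j = u' j) \<Longrightarrow> (\<And>j. j < d \<Longrightarrow> c j = c' j) \<Longrightarrow> active u c d = active u' c' d"
  unfolding active_def using leading_zeros_cong[of "Suc d" u u'] prefix_value_cong[of d c c'] by simp

lemma source_cong:
  assumes "\<And>j. j \<le> d \<Longrightarrow> u j = u' j" "\<And>j. j < d \<Longrightarrow> c j = c' j"
  shows "source u c d = source u' c' d"
proof -
  have "active u c d = active u' c' d" "active u c (d - 1) = active u' c' (d - 1)"
    using assms by (auto intro!: active_cong)
  moreover have "leading_zeros u d = leading_zeros u' d" using assms(1) by (intro leading_zeros_cong) simp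
  ultimately show ?thesis by (simp add: source_def)
qed

lemma active_iff:
  assumes "first_one u i"
  shows "active u c d \<longleftrightarrow> i \<le> d \<and> G i d (prefix_value c d)"
  unfolding active_def leading_zeros_eq_min[OF assms] by (auto simp: min_def)

lemma not_active: "(\<And>j. j \<le> d \<Longrightarrow> \<not> u j) \<Longrightarrow> \<not> active u c d"
  unfolding active_def by (subst leading_zeros_eq_self) auto

lemma source_eq_self: "(\<And>j. j \<le> d \<Longrightarrow> \<not> u j) \<Longrightarrow> source u c d = d"
  unfolding source_def using not_active by simp

lemma source_eq:
  assumes "first_one u i" "i \<le> d"
  shows "source u c d = (if active u c d then Suc d else if d > i \<and> active u c (d - 1) then i else d)"
  unfolding source_def leading_zeros_eq_min[OF assms(1)] active_iff[OF assms(1)] using assms(2) by auto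

lemma source_le: "source u c d \<le> Suc d"
  using leading_zeros_le[of u d] by (simp add: source_def)

lemma active_downward:
  assumes "active u c d" "first_one u i" "i \<le> e" "e \<le> d"
  shows "active u c e"
  using assms(4)
proof (induction rule: inc_induct)
  case (step m)
  then have "G i (Suc m) (prefix_value c (Suc m))" by (simp only: active_iff[OF assms(2)])
  from nested[OF this] have "G i m (prefix_value c m)" unfolding prefix_value_div2 .
  with step(1) assms(3) show ?case by (simp add: active_iff[OF assms(2)])
qed (rule assms(1))

text \<open>
  The cells \<open>i, ..., d\<close> are permuted cyclically, or all the cells from \<open>i\<close> on are shifted.
  Injectivity is what makes the shuffle surjective: no two cells receive the same card, so every
  target deck is the image of some deck.
\<close>
lemma inj_source: "inj (source u c)"
proof (cases u rule: first_one_cases)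
  case 1
  then show ?thesis by (simp add: source_eq_self inj_def)
next
  case (2 i)
  have low: "source u c d = d" if "d < i" for d
    using 2 that by (intro source_eq_self) (auto simp: first_one_def)
  have high: "source u c d =
      (if active u c d then Suc d else if d > i \<and> active u c (d - 1) then i else d)" if "d \<ge> i" for d
    using that by (rule source_eq[OF 2])
  have "source u c d \<noteq> source u c e" if "d < e" for d e
  proof (cases "i \<le> d")
    case True
    have down: "active u c e \<Longrightarrow> active u c d" "active u c e \<Longrightarrow> active u c (e - 1)"
        "active u c (e - 1) \<Longrightarrow> active u c d" "i < d \<Longrightarrow> active u c d \<Longrightarrow> active u c (d - 1)"
      using that True by (auto intro: active_downward[OF _ 2])
    show ?thesis
      using True that down high[OF True] high[of e] by (auto split: if_splits)
  next
    case False
    then have "i \<le> e \<Longrightarrow> i \<le> source u c e" using high[of e] by simp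
    with False that low[of d] low[of e] show ?thesis by (cases "i \<le> e") auto
  qed
  then show ?thesis by (metis injI linorder_neqE_nat)
qed

lemma selector_shuffle [simp]: "selector (shuffle z) = selector z"
  and clock_shuffle [simp]: "clock (shuffle z) = odometer (clock z)"
  and deck_shuffle: "deck (shuffle z) k = deck z (K * source (selector z) (clock z) (k div K) + k mod K)"
  by (simp_all add: shuffle_def)

lemma selector_funpow [simp]: "selector ((shuffle ^^ t) z) = selector z"
  by (induction t) auto

lemma clock_funpow [simp]: "clock ((shuffle ^^ t) z) = (odometer ^^ t) (clock z)"
  by (induction t) auto

lemma surj_shuffle: "surj shuffle"
  unfolding surj_def
proof
  fix z
  obtain c where c: "odometer c = clock z" using surj_odometer by (metis surjD)
  define s where "s k = K * source (selector z) c (k div K) + k mod K" for k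
  have "inj s"
  proof (rule injI)
    fix k l assume eq: "s k = s l"
    have s: "s k div K = source (selector z) c (k div K)" "s k mod K = k mod K" for k
      using K_pos by (simp_all add: s_def)
    have "source (selector z) c (k div K) = source (selector z) c (l div K)"
      using s(1)[of k] s(1)[of l] eq by simp
    then have "k div K = l div K" by (rule injD[OF inj_source])
    moreover have "k mod K = l mod K" using s(2)[of k] s(2)[of l] eq by simp
    ultimately show "k = l" by (metis div_mult_mod_eq)
  qed
  then have "deck z (inv s (s k)) = deck z k" for k by simp
  then have "z = shuffle (join_tracks (selector z) c (\<lambda>k. deck z (inv s k)))"
    unfolding shuffle_def by (simp add: c join_tracks_split s_def[symmetric])
  then show "\<exists>y. z = shuffle y" by blast
qed

text \<open>
  A symbol in cell \<open>d\<close> of the deck comes from cell \<open>d + 1\<close> or above, at most \<open>K\<close> places further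
  on in its track and \<open>3 * K\<close> places further on in the sequence; the selector and clock symbols
  that decide about it come earlier.
\<close>
lemma shuffle_cong:
  assumes "\<And>k. k < n + 3 * K \<Longrightarrow> z k = z' k" "k < n"
  shows "shuffle z k = shuffle z' k"
proof -
  let ?q = "k div 3"
  have "3 * ?q + k mod 3 = k" by simp
  then have q: "3 * ?q + k mod 3 < n" using assms(2) by simp
  have sel: "selector z j = selector z' j" if "j \<le> ?q" for j
    unfolding selector_def by (rule assms(1)) (use q that in linarith)
  have bound: "3 * a + 2 < n + 3 * K" if "a \<le> q + K" "3 * q + 2 < n" for a q
    using that by linarith
  show ?thesis
  proof (cases "k mod 3 = 2")
    case True
    let ?d = "?q div K"
    have clk: "clock z j = clock z' j" if "j \<le> ?q" for j
      unfolding clock_def by (rule assms(1)) (use q True that in linarith)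
    have "?d \<le> ?q" by simp
    then have src: "source (selector z) (clock z) ?d = source (selector z') (clock z') ?d"
      by (intro source_cong sel clk) linarith+
    have "K * source (selector z') (clock z') ?d \<le> K * Suc ?d"
      by (intro mult_left_mono source_le) simp
    moreover have "K * ?d + ?q mod K = ?q" by simp
    ultimately have "K * source (selector z') (clock z') ?d + ?q mod K \<le> ?q + K"
      unfolding mult_Suc_right by linarith
    moreover have "3 * ?q + 2 < n" using q True by simp
    ultimately have "3 * (K * source (selector z') (clock z') ?d + ?q mod K) + 2 < n + 3 * K"
      by (rule bound)
    then have "deck z (K * source (selector z') (clock z') ?d + ?q mod K)
        = deck z' (K * source (selector z') (clock z') ?d + ?q mod K)"
      unfolding deck_def by (rule assms(1))
    then show ?thesis unfolding shuffle_def join_tracks_def src using True by simp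
  next
    case False
    have "odometer (clock z) ?q = odometer (clock z') ?q" if "k mod 3 = 1"
    proof (rule odometer_cong)
      fix j assume "j \<le> ?q"
      then show "clock z j = clock z' j"
        unfolding clock_def by (intro assms(1)) (use q that in linarith)
    qed
    moreover from False have "k mod 3 = 0 \<or> k mod 3 = 1" by presburger
    ultimately show ?thesis using sel[of ?q] unfolding shuffle_def join_tracks_def by auto
  qed
qed

end

context card_insertion
begin

section \<open>Counting the clock values that reach a depth\<close>

definition good :: "nat \<Rightarrow> nat \<Rightarrow> nat" where
  "good i d = card {R. R < 2 ^ d \<and> G i d R}"

lemma good_eq_sum: "good i d = (\<Sum>R<2 ^ d. of_bool (G i d R))"
proof -
  have "{R. R < 2 ^ d \<and> G i d R} = {..<2 ^ d} \<inter> {R. G i d R}" by auto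
  then show ?thesis by (simp add: good_def)
qed

text \<open>
  Nesting makes \<open>good i d / 2 ^ d\<close> decrease with \<open>d\<close>; its limit is the frequency with which the
  whole deck is shifted.
\<close>
lemma good_Suc_le: "good i (Suc d) \<le> 2 * good i d"
proof -
  let ?A = "{R. R < 2 ^ Suc d \<and> G i (Suc d) R}" and ?B = "{R. R < 2 ^ d \<and> G i d R}"
  have "card ?A \<le> card (?B \<times> {..<2::nat})"
  proof (rule card_inj_on_le)
    show "inj_on (\<lambda>R. (R div 2, R mod 2)) ?A"
      by (rule inj_onI) (metis Pair_inject div_mult_mod_eq)
    show "(\<lambda>R. (R div 2, R mod 2)) ` ?A \<subseteq> ?B \<times> {..<2}"
      using nested by (auto simp: less_mult_imp_div_less mult.commute)
  qed simp
  then show ?thesis by (simp add: good_def mult.commute)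
qed

lemma good_le_scale: "d \<le> e \<Longrightarrow> good i e \<le> 2 ^ (e - d) * good i d"
proof (induction rule: dec_induct)
  case (step m)
  then have "good i (Suc m) \<le> 2 * (2 ^ (m - d) * good i d)"
    using good_Suc_le[of i m] by linarith
  with step(1) show ?case by (simp add: Suc_diff_le)
qed simp

lemma source_ge:
  assumes "first_one u i" "i \<le> d"
  shows "i \<le> source u c d"
  using assms(2) by (simp add: source_eq[OF assms])

section \<open>Lower bound for the entropy\<close>

text \<open>
  The initial cell of the card that is in cell \<open>d\<close> at time \<open>t\<close>.
\<close>
primrec origin :: "(nat \<Rightarrow> bool) \<Rightarrow> (nat \<Rightarrow> bool) \<Rightarrow> nat \<Rightarrow> nat \<Rightarrow> nat" where
  "origin u c 0 d = d"
| "origin u c (Suc t) d = origin u c t (source u ((odometer ^^ t) c) d)"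

lemma deck_funpow:
  "r < K \<Longrightarrow> deck ((shuffle ^^ t) z) (K * d + r) = deck z (K * origin (selector z) (clock z) t d + r)"
proof (induction t arbitrary: d)
  case (Suc t)
  have "(K * d + r) div K = d" "(K * d + r) mod K = r" using Suc.prems by simp_all
  then have "deck ((shuffle ^^ Suc t) z) (K * d + r) =
      deck ((shuffle ^^ t) z) (K * source (selector z) ((odometer ^^ t) (clock z)) d + r)"
    by (simp add: deck_shuffle)
  also have "\<dots> = deck z (K * origin (selector z) (clock z) (Suc t) d + r)"
    using Suc by simp
  finally show ?case .
qed simp

lemma inj_origin: "inj (origin u c t)"
proof (induction t)
  case (Suc t)
  have "origin u c (Suc t) = origin u c t \<circ> source u ((odometer ^^ t) c)" by auto
  with Suc show ?case by (metis inj_compose inj_source)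
qed (simp add: inj_def)

lemma origin_backtrack:
  assumes "first_one u i" "s \<le> t" "i \<le> d"
  obtains e where "i \<le> e" "e \<le> d + (t - s)" "origin u c t d = origin u c s e"
proof -
  from assms(2,3) have "\<exists>e\<ge>i. e \<le> d + (t - s) \<and> origin u c t d = origin u c s e"
  proof (induction t arbitrary: d rule: dec_induct)
    case (step m)
    let ?d = "source u ((odometer ^^ m) c) d"
    from step.IH[of ?d] source_ge[OF assms(1) step.prems]
    obtain e where e: "e \<ge> i" "e \<le> ?d + (m - s)" "origin u c m ?d = origin u c s e" by blast
    moreover have "e \<le> d + (Suc m - s)"
      using e(2) source_le[of u "(odometer ^^ m) c" d] step(1) by linarith
    ultimately show ?case by auto
  qed auto
  with that show ?thesis by blast
qed

text \<open>
  A card that is on top while cell \<open>i + n\<close> is active goes to a cell beyond \<open>i + n\<close> or leaves the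
  deck for good.  As it rises by at most one cell in a step, it is not on top again up to time
  \<open>n\<close>.  So the cards on top at such times are all different.
\<close>
lemma origin_top_inject:
  assumes "first_one u i" "s < t" "t \<le> n" "active u ((odometer ^^ s) c) (i + n)"
  shows "origin u c s i \<noteq> origin u c t i"
proof
  assume eq: "origin u c s i = origin u c t i"
  from origin_backtrack[OF assms(1), of "Suc s" t i c] assms(2)
  obtain e where e: "i \<le> e" "e \<le> i + (t - Suc s)" "origin u c t i = origin u c (Suc s) e" by auto
  then have "active u ((odometer ^^ s) c) e"
    using assms(2,3) by (intro active_downward[OF assms(4,1)]) auto
  then have "origin u c t i = origin u c s (Suc e)"
    using e by (simp add: source_eq[OF assms(1)])
  with eq have "i = Suc e" using injD[OF inj_origin] by metis
  with e(1) show False by simp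
qed

text \<open>
  Only the top card is observed.  Over \<open>n\<close> steps, starting the clock in a window that is at least
  average, at least \<open>n * good i (i + n) / 2 ^ (i + n)\<close> different cards come to the top, and the
  \<open>K\<close> bits of each of them may be chosen freely.
\<close>
lemma le_topological_entropy_shuffle:
  assumes "\<And>d. y * 2 ^ d \<le> real (K * good i d)"
  shows "ereal y \<le> topological_entropy shuffle"
proof -
  let ?W = "{w :: bool list. set w \<subseteq> UNIV \<and> length w = K}"
  define C where "C w = {z. map (\<lambda>r. deck z (K * i + r)) [0..<K] = w}" for w
  let ?\<U> = "C ` ?W"
  have open_C: "open (C w)" for w
  proof (rule open_finitely_determined)
    fix z z' assume eq: "\<forall>k<3 * (K * i + K) + 3. z k = z' k" and z: "z \<in> C w"
    have "deck z (K * i + r) = deck z' (K * i + r)" if "r < K" for r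
      using eq that by (simp add: deck_def)
    then have "map (\<lambda>r. deck z (K * i + r)) [0..<K] = map (\<lambda>r. deck z' (K * i + r)) [0..<K]" by simp
    with z show "z' \<in> C w" by (simp add: C_def)
  qed
  have cover: "\<Union>?\<U> = UNIV"
  proof -
    have "z \<in> \<Union>?\<U>" for z
    proof (rule UnionI)
      show "C (map (\<lambda>r. deck z (K * i + r)) [0..<K]) \<in> ?\<U>" by (rule imageI) simp
      show "z \<in> C (map (\<lambda>r. deck z (K * i + r)) [0..<K])" by (simp add: C_def)
    qed
    then show ?thesis by blast
  qed
  have fin: "finite ?\<U>" by (intro finite_imageI finite_lists_length_eq) simp
  have foc: "finite_open_cover ?\<U>"
    unfolding finite_open_cover_def using fin cover open_C by auto
  have "y \<le> cover_entropy shuffle ?\<U>"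
  proof (rule le_cover_entropy)
    fix n :: nat assume "n \<ge> 1"
    let ?L = "i + n" and ?u = "\<lambda>j. j = i"
    have u: "first_one ?u i" by (simp add: first_one_def)
    obtain s where s: "n * (\<Sum>R<2 ^ ?L. of_bool (G i ?L R) :: nat) \<le>
        2 ^ ?L * (\<Sum>t<n. of_bool (G i ?L (prefix_value ((odometer ^^ (t + s)) (\<lambda>_. False)) ?L)))"
      by (rule odometer_window_above_average)
    (* The clock from which the selected window starts. *)
    define c where "c = (odometer ^^ s) (\<lambda>_. False)"
    define T where "T = {t. t < n \<and> active ?u ((odometer ^^ t) c) ?L}"
    have T: "finite T" by (simp add: T_def)
    have "T = {..<n} \<inter> {t. G i ?L (prefix_value ((odometer ^^ (t + s)) (\<lambda>_. False)) ?L)}"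
      unfolding T_def active_iff[OF u] c_def by (auto simp: funpow_add)
    then have "card T = (\<Sum>t<n. of_bool (G i ?L (prefix_value ((odometer ^^ (t + s)) (\<lambda>_. False)) ?L)))"
      by simp
    with s have sT: "n * good i ?L \<le> 2 ^ ?L * card T" unfolding good_eq_sum by simp
    have injT: "inj_on (\<lambda>t. origin ?u c t i) T"
    proof (rule inj_onI, rule ccontr)
      fix s t assume "s \<in> T" "t \<in> T" "origin ?u c s i = origin ?u c t i" "s \<noteq> t"
      then show False
        using origin_top_inject[OF u, of s t n c] origin_top_inject[OF u, of t s n c]
        by (cases s t rule: linorder_cases) (auto simp: T_def)
    qed
    define P where "P = (\<lambda>(t, r). K * origin ?u c t i + r) ` (T \<times> {..<K})"
    have "inj_on (\<lambda>(t, r). K * origin ?u c t i + r) (T \<times> {..<K})"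
    proof (rule inj_onI)
      fix p q assume pq: "p \<in> T \<times> {..<K}" "q \<in> T \<times> {..<K}"
        "(\<lambda>(t, r). K * origin ?u c t i + r) p = (\<lambda>(t, r). K * origin ?u c t i + r) q"
      obtain t r t' r' where p: "p = (t, r)" and q: "q = (t', r')" by (cases p, cases q)
      with pq have in_T: "t \<in> T" "t' \<in> T" and r: "r < K" "r' < K"
        and eq: "K * origin ?u c t i + r = K * origin ?u c t' i + r'" by auto
      have "(K * origin ?u c t i + r) div K = origin ?u c t i" "(K * origin ?u c t i + r) mod K = r"
        "(K * origin ?u c t' i + r') div K = origin ?u c t' i" "(K * origin ?u c t' i + r') mod K = r'"
        using r by simp_all
      with eq have "origin ?u c t i = origin ?u c t' i" "r = r'" by simp_all
      then show "p = q" using inj_onD[OF injT _ in_T] p q by simp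
    qed
    then have card_P: "card P = card T * K" unfolding P_def by (simp add: card_image card_cartesian_product)
    have fin_P: "finite P" unfolding P_def using T by simp
    define Z where "Z = (\<lambda>A. join_tracks ?u c (\<lambda>k. k \<in> A)) ` Pow P"
    have "inj_on (\<lambda>A. join_tracks ?u c (\<lambda>k. k \<in> A)) (Pow P)"
    proof (rule inj_onI)
      fix A B assume "join_tracks ?u c (\<lambda>k. k \<in> A) = join_tracks ?u c (\<lambda>k. k \<in> B)"
      then have "deck (join_tracks ?u c (\<lambda>k. k \<in> A)) = deck (join_tracks ?u c (\<lambda>k. k \<in> B))" by simp
      then show "A = B" by (simp add: fun_eq_iff set_eq_iff)
    qed
    then have card_Z: "card Z = 2 ^ (card T * K)"
      unfolding Z_def using fin_P by (simp add: card_image card_Pow card_P)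
    have "card Z \<le> min_subcover_card shuffle ?\<U> n"
    proof (rule card_separated_le_min_subcover_card[OF fin cover])
      fix y z assume "y \<in> Z" "z \<in> Z" "y \<noteq> z"
      then obtain A B where AB: "A \<subseteq> P" "B \<subseteq> P" "A \<noteq> B"
        "y = join_tracks ?u c (\<lambda>k. k \<in> A)" "z = join_tracks ?u c (\<lambda>k. k \<in> B)"
        unfolding Z_def by blast
      then obtain k where k: "k \<in> P" "(k \<in> A) \<noteq> (k \<in> B)" by blast
      then obtain t r where tr: "t \<in> T" "r < K" "k = K * origin ?u c t i + r" unfolding P_def by auto
      have "deck ((shuffle ^^ t) y) (K * i + r) \<noteq> deck ((shuffle ^^ t) z) (K * i + r)"
        using k(2) by (simp add: deck_funpow[OF tr(2)] AB(4,5) tr(3))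
      then have "\<not> ((shuffle ^^ t) y \<in> C w \<and> (shuffle ^^ t) z \<in> C w)" for w
        using tr(2) unfolding C_def by (auto simp: list_eq_iff_nth_eq)
      moreover have "t < n" using tr(1) by (simp add: T_def)
      ultimately show "\<exists>t<n. \<forall>U\<in>?\<U>. (shuffle ^^ t) y \<in> U \<longrightarrow> (shuffle ^^ t) z \<notin> U" by blast
    qed
    moreover have "y * real n \<le> real (card T * K)"
    proof -
      have "y * real n * 2 ^ ?L = real n * (y * 2 ^ ?L)" by simp
      also have "\<dots> \<le> real n * real (K * good i ?L)" by (intro mult_left_mono assms) simp
      also have "\<dots> = real K * real (n * good i ?L)" by simp
      also have "\<dots> \<le> real K * real (2 ^ ?L * card T)" by (intro mult_left_mono of_nat_mono sT) simp
      also have "\<dots> = real (card T * K) * 2 ^ ?L" by simp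
      finally show ?thesis by (rule mult_right_le_imp_le) simp
    qed
    ultimately show "\<exists>b. 2 ^ b \<le> min_subcover_card shuffle ?\<U> n \<and> y * real n \<le> real b"
      unfolding card_Z by blast
  qed
  then have "ereal y \<le> ereal (cover_entropy shuffle ?\<U>)" by simp
  also have "\<dots> \<le> topological_entropy shuffle"
    unfolding topological_entropy_def using foc by (intro SUP_upper) blast
  finally show ?thesis .
qed

section \<open>Upper bound for the entropy\<close>

text \<open>
  A card from outside the cells \<open>0, ..., d\<close> enters them exactly when cell \<open>d\<close> is active.  To follow
  the first \<open>m\<close> symbols of an orbit this matters only for a selector with a one before place \<open>m\<close>:
  otherwise the cells before \<open>m\<close> are at rest.  Only finitely many selector values \<open>i\<close> are left, and
  one depth \<open>d\<close> serves them all.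
\<close>
definition entering :: "nat \<Rightarrow> nat \<Rightarrow> (nat \<Rightarrow> bool) \<Rightarrow> nat \<Rightarrow> bool" where
  "entering m d z t \<longleftrightarrow> (\<exists>j<m. selector z j) \<and> active (selector z) ((odometer ^^ t) (clock z)) d"

text \<open>
  An initial block of the sequence, followed by the cards that enter from below.
\<close>
primrec history :: "nat \<Rightarrow> nat \<Rightarrow> (nat \<Rightarrow> bool) \<Rightarrow> nat \<Rightarrow> bool list" where
  "history m d z 0 = map z [0..<3 * (K * Suc d)]"
| "history m d z (Suc t) = history m d z t @
    (if entering m d z t then map (deck ((shuffle ^^ t) z)) [K * Suc d..<K * Suc d + K] else [])"

text \<open>
  What the history determines at every time: the initial blocks of the selector and the clock,
  and of the deck the cells up to \<open>d\<close>, or just the resting cells before \<open>m\<close> if the entering cards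
  are not recorded.
\<close>
definition agree :: "nat \<Rightarrow> nat \<Rightarrow> (nat \<Rightarrow> bool) \<Rightarrow> (nat \<Rightarrow> bool) \<Rightarrow> bool" where
  "agree m d z z' \<longleftrightarrow> (\<forall>k<K * Suc d. selector z k = selector z' k \<and> clock z k = clock z' k) \<and>
    (\<forall>k<K * Suc d. (\<exists>j<m. selector z j) \<or> k div K < m \<longrightarrow> deck z k = deck z' k)"

lemma length_history:
  "length (history m d z t) = 3 * (K * Suc d) + K * (\<Sum>s<t. of_bool (entering m d z s))"
  by (induction t) (auto simp: algebra_simps)

lemma le_K_mult: "x \<le> K * x"
  using K_pos by simp

lemma agree_prefix:
  assumes "agree m d z z'" "m \<le> d" "k < m"
  shows "z k = z' k"
proof -
  have less: "k div 3 < K * Suc d" using assms(2,3) le_K_mult[of "Suc d"] by linarith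
  have "k div 3 div K \<le> k" by (metis div_le_dividend le_trans)
  then have "k div 3 div K < m" using assms(3) by simp
  with less assms(1) have "selector z (k div 3) = selector z' (k div 3)"
    "clock z (k div 3) = clock z' (k div 3)" "deck z (k div 3) = deck z' (k div 3)"
    unfolding agree_def by blast+
  then have "join_tracks (selector z) (clock z) (deck z) k = join_tracks (selector z') (clock z') (deck z') k"
    by (simp add: join_tracks_def)
  then show ?thesis by (simp add: join_tracks_split)
qed

lemma agree_shuffle:
  assumes agree: "agree m d z z'" and "m \<le> d"
    and new: "entering m d z 0 \<Longrightarrow> \<forall>k\<in>{K * Suc d..<K * Suc d + K}. deck z k = deck z' k"
  shows "agree m d (shuffle z) (shuffle z')"
proof -
  have sel: "selector z k = selector z' k" and clk: "clock z k = clock z' k" if "k < K * Suc d" for k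
    using agree that by (auto simp: agree_def)
  have dck: "deck z k = deck z' k" if "k < K * Suc d" "(\<exists>j<m. selector z j) \<or> k div K < m" for k
    using agree that by (auto simp: agree_def)
  have d: "j \<le> d \<Longrightarrow> j < K * Suc d" for j using le_K_mult[of "Suc d"] by linarith
  have "odometer (clock z) k = odometer (clock z') k" if "k < K * Suc d" for k
    using that by (intro odometer_cong clk) auto
  moreover have "deck (shuffle z) k = deck (shuffle z') k"
    if k: "k < K * Suc d" "(\<exists>j<m. selector z j) \<or> k div K < m" for k
  proof -
    let ?e = "k div K"
    have e: "?e \<le> d" using k(1) by (simp add: less_mult_imp_div_less mult.commute flip: less_Suc_eq_le)
    have src: "source (selector z) (clock z) ?e = source (selector z') (clock z') ?e"
      using e by (intro source_cong sel clk d) auto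
    let ?k = "K * source (selector z) (clock z) ?e + k mod K"
    have "deck z ?k = deck z' ?k"
    proof (cases "\<exists>j<m. selector z j")
      case True
      show ?thesis
      proof (cases "source (selector z) (clock z) ?e \<le> d")
        case le: True
        have "?k < K * source (selector z) (clock z) ?e + K" using K_pos by simp
        also have "\<dots> \<le> K * Suc d" using mult_le_mono2[OF le, of K] by simp
        finally show ?thesis using True by (intro dck) auto
      next
        case False
        then have "source (selector z) (clock z) ?e = Suc d" "?e = d"
          using source_le[of "selector z" "clock z" ?e] e by linarith+
        moreover from this have "active (selector z) (clock z) d"
          using leading_zeros_le[of "selector z" d] by (auto simp: source_def split: if_splits)
        with True have "entering m d z 0" by (simp add: entering_def)
        moreover have "k mod K < K" using K_pos by simp
        ultimately show ?thesis using new by auto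
      qed
    next
      case False
      with k(2) have "source (selector z) (clock z) ?e = ?e" by (intro source_eq_self) auto
      then have "?k = k" by simp
      with dck[OF k] show ?thesis by simp
    qed
    then show ?thesis by (simp add: deck_shuffle src)
  qed
  ultimately show ?thesis using sel unfolding agree_def by auto
qed

lemma entering_cong:
  assumes "agree m d z z'" "m \<le> d"
  shows "entering m d z t = entering m d z' t"
proof -
  have d: "j \<le> d \<Longrightarrow> j < K * Suc d" for j using le_K_mult[of "Suc d"] by linarith
  have sel: "selector z j = selector z' j" if "j \<le> d" for j
    using assms(1) d[OF that] by (auto simp: agree_def)
  have clk: "\<forall>j<K * Suc d. (odometer ^^ t) (clock z) j = (odometer ^^ t) (clock z') j"
  proof (induction t)
    case 0
    then show ?case using assms(1) by (simp add: agree_def)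
  next
    case (Suc t)
    show ?case
      unfolding funpow.simps o_apply using Suc by (intro allI impI odometer_cong) auto
  qed
  have "active (selector z) ((odometer ^^ t) (clock z)) d = active (selector z') ((odometer ^^ t) (clock z')) d"
    using clk d by (intro active_cong sel) auto
  moreover have "(\<exists>j<m. selector z j) = (\<exists>j<m. selector z' j)" using sel assms(2) by auto
  ultimately show ?thesis by (simp add: entering_def)
qed

lemma take_history: "take (3 * (K * Suc d)) (history m d z t) = map z [0..<3 * (K * Suc d)]"
proof (induction t)
  case (Suc t)
  have "3 * (K * Suc d) \<le> length (history m d z t)" unfolding length_history by simp
  with Suc show ?case by simp
qed simp

lemma history_eq_imp_agree_start:
  assumes "history m d z t = history m d z' t"
  shows "agree m d z z'"
proof -
  let ?N = "3 * (K * Suc d)"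
  have "map z [0..<?N] = map z' [0..<?N]"
    using take_history[of d m z t] take_history[of d m z' t] assms by simp
  then have eq: "z k = z' k" if "k < ?N" for k using that by simp
  show ?thesis unfolding agree_def selector_def clock_def deck_def
    by (intro conjI allI impI eq) linarith+
qed

text \<open>
  The initial block fixes at which times cards are recorded, so equal histories split at the
  same places; then the agreement is carried along the orbits step by step.
\<close>
lemma history_eq_imp_agree:
  assumes "history m d z n = history m d z' n" "t \<le> n" "m \<le> d"
  shows "agree m d ((shuffle ^^ t) z) ((shuffle ^^ t) z')"
proof -
  have start: "agree m d z z'" using assms(1) by (rule history_eq_imp_agree_start)
  have ent: "entering m d z t = entering m d z' t" for t by (rule entering_cong[OF start assms(3)])
  have len: "length (history m d z t) = length (history m d z' t)" for t
    unfolding length_history ent ..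
  have hist: "history m d z t = history m d z' t" if "t \<le> n" for t
    using that
  proof (induction rule: inc_induct)
    case (step t)
    then show ?case using len[of t] by simp
  qed (rule assms(1))
  show ?thesis using assms(2)
  proof (induction t)
    case (Suc t)
    have "agree m d (shuffle ((shuffle ^^ t) z)) (shuffle ((shuffle ^^ t) z'))"
    proof (rule agree_shuffle)
      assume "entering m d ((shuffle ^^ t) z) 0"
      then have "entering m d z t" by (simp add: entering_def)
      with hist[of t] hist[of "Suc t"] Suc.prems ent[of t] 
      have "map (deck ((shuffle ^^ t) z)) [K * Suc d..<K * Suc d + K]
        = map (deck ((shuffle ^^ t) z')) [K * Suc d..<K * Suc d + K]"
        by (simp del: map_eq_conv)
      then show "\<forall>k\<in>{K * Suc d..<K * Suc d + K}. deck ((shuffle ^^ t) z) k = deck ((shuffle ^^ t) z') k"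
        by simp
    qed (use Suc assms(3) in auto)
    then show ?case by simp
  qed (simp add: start)
qed

lemma entering_sum_le:
  assumes "\<And>i. i < m \<Longrightarrow> good i d \<le> b"
  shows "(\<Sum>t<s * 2 ^ d. of_bool (entering m d z t)) \<le> s * b"
proof (cases "\<exists>j<m. selector z j")
  case True
  obtain i where i: "first_one (selector z) i"
    using True by (cases "selector z" rule: first_one_cases) auto
  with True have "i < m" by (metis first_one_def linorder_neqE_nat order_less_trans)
  have "(\<Sum>t<s * 2 ^ d. of_bool (entering m d z t)) \<le>
      (\<Sum>t<s * 2 ^ d. of_bool (G i d (prefix_value ((odometer ^^ t) (clock z)) d)) :: nat)"
    by (rule sum_mono) (auto simp: entering_def active_iff[OF i])
  also have "\<dots> = s * good i d"
    unfolding good_eq_sum by (rule sum_prefix_value_odometer_multiple)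
  also have "\<dots> \<le> s * b" using assms[OF \<open>i < m\<close>] by simp
  finally show ?thesis .
next
  case False
  then have "\<not> entering m d z t" for t by (simp add: entering_def)
  then show ?thesis by simp
qed

lemma card_bool_lists_le: "card {l :: bool list. length l \<le> b} \<le> 2 ^ Suc b"
proof -
  have "card {l :: bool list. length l \<le> b} = (\<Sum>i\<le>b. 2 ^ i)"
    using card_lists_length_le[of "UNIV :: bool set" b] by (simp add: card_UNIV_bool)
  also have "\<dots> \<le> 2 ^ Suc b" by (induction b) auto
  finally show ?thesis .
qed

text \<open>
  The histories of \<open>n\<close> steps are binary words, of length \<open>K\<close> times the number of entering cards up
  to an additive constant.  When \<open>n\<close> is a multiple of the period \<open>2 ^ d\<close>, that number is known
  exactly: \<open>good i d\<close> cards enter in each period, whatever the clock.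
\<close>
lemma topological_entropy_shuffle_le:
  assumes "\<And>i e. e > 0 \<Longrightarrow> \<exists>d. real (K * good i d) \<le> 2 ^ d * (h + e)"
  shows "topological_entropy shuffle \<le> ereal h"
  unfolding topological_entropy_def
proof (rule SUP_least)
  fix \<U> :: "(nat \<Rightarrow> bool) set set" assume "\<U> \<in> {\<U>. finite_open_cover \<U>}"
  then have foc: "finite_open_cover \<U>" by simp
  then obtain m where m: "\<And>z. \<exists>U\<in>\<U>. {y. \<forall>k<m. y k = z k} \<subseteq> U"
    using finite_open_cover_cylinders by blast
  have "cover_entropy shuffle \<U> \<le> h + e" if "e > 0" for e
  proof -
    define e' where "e' = e / 2"
    have e': "e' > 0" "e = e' + e'" using that by (simp_all add: e'_def)
    (* Monotonicity in the depth turns the depths given for single selector values into one depth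
       for all of the values up to m. *)
    have "\<forall>\<^sub>F d in sequentially. real (K * good i d) \<le> 2 ^ d * (h + e')" for i
    proof -
      obtain d where d: "real (K * good i d) \<le> 2 ^ d * (h + e')" using assms e'(1) by blast
      have "real (K * good i b) \<le> 2 ^ b * (h + e')" if "d \<le> b" for b
      proof -
        have "real (K * good i b) \<le> real (2 ^ (b - d) * (K * good i d))"
          using mult_le_mono2[OF good_le_scale[OF that, of i], of K]
          by (intro of_nat_mono) (simp add: mult.left_commute)
        also have "\<dots> = 2 ^ (b - d) * real (K * good i d)" by simp
        also have "\<dots> \<le> 2 ^ (b - d) * (2 ^ d * (h + e'))" using d by (intro mult_left_mono) auto
        also have "\<dots> = 2 ^ b * (h + e')" using that by (simp add: mult.assoc[symmetric] flip: power_add)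
        finally show ?thesis .
      qed
      then show ?thesis unfolding eventually_sequentially by blast
    qed
    then have "\<forall>\<^sub>F d in sequentially. \<forall>i\<in>{..m}. real (K * good i d) \<le> 2 ^ d * (h + e')"
      by (intro eventually_ball_finite) auto
    from eventually_happens'[OF sequentially_bot eventually_conj[OF eventually_ge_at_top[of m] this]]
    obtain d where d: "m \<le> d" "\<And>i. i \<le> m \<Longrightarrow> real (K * good i d) \<le> 2 ^ d * (h + e')"
      by auto
    define b where "b = Max ((\<lambda>i. good i d) ` {..m})"
    have b: "good i d \<le> b" if "i < m" for i unfolding b_def using that by (intro Max_ge) auto
    have "b \<in> (\<lambda>i. good i d) ` {..m}" unfolding b_def by (rule Max_in) auto
    then have Kb: "real (K * b) \<le> 2 ^ d * (h + e')" using d(2) by auto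
    define M where "M = 3 * (K * Suc d)"
    obtain s :: nat where s: "real (M + 1) / e' \<le> real s" "s \<ge> 1"
      using real_arch_simple[of "max 1 (real (M + 1) / e')"] by auto
    define n where "n = s * 2 ^ d"
    have n: "n \<ge> 1" "real (M + 1) \<le> e' * real n"
    proof -
      show "n \<ge> 1" using s(2) by (simp add: n_def)
      have "real (M + 1) \<le> e' * real s" using s(1) e'(1) by (simp add: pos_divide_le_eq mult.commute)
      also have "\<dots> \<le> e' * real n"
        using e'(1) mult_le_mono2[of 1 "2 ^ d" s] by (intro mult_left_mono of_nat_mono) (simp_all add: n_def)
      finally show "real (M + 1) \<le> e' * real n" .
    qed
    let ?b = "M + K * (s * b)"
    have len: "range (\<lambda>z. history m d z n) \<subseteq> {l. length l \<le> ?b}"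
      unfolding length_history M_def n_def using entering_sum_le[of m d b, OF b] by (auto simp: length_history)
    have fin: "finite {l :: bool list. length l \<le> ?b}"
      using finite_lists_length_le[of "UNIV :: bool set" ?b] by simp
    have "min_subcover_card shuffle \<U> n \<le> card (range (\<lambda>z. history m d z n))"
    proof (rule min_subcover_card_le)
      fix z t assume "t < n"
      from m[of "(shuffle ^^ t) z"] obtain U where
        U: "U \<in> \<U>" "{y. \<forall>k<m. y k = (shuffle ^^ t) z k} \<subseteq> U" by blast
      have "(shuffle ^^ t) y \<in> U" if "history m d y n = history m d z n" for y
      proof -
        have "agree m d ((shuffle ^^ t) y) ((shuffle ^^ t) z)"
          using that \<open>t < n\<close> d(1) by (intro history_eq_imp_agree) auto
        then have "(shuffle ^^ t) y k = (shuffle ^^ t) z k" if "k < m" for k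
          using d(1) that by (rule agree_prefix)
        then show ?thesis by (intro subsetD[OF U(2)] CollectI allI impI)
      qed
      with U(1) show "\<exists>U\<in>\<U>. \<forall>y. history m d y n = history m d z n \<longrightarrow> (shuffle ^^ t) y \<in> U" by blast
    qed (rule finite_subset[OF len fin])
    also have "\<dots> \<le> card {l :: bool list. length l \<le> ?b}" by (rule card_mono[OF fin len])
    also have "\<dots> \<le> 2 ^ Suc ?b" by (rule card_bool_lists_le)
    finally have "cover_entropy shuffle \<U> \<le> real (Suc ?b) / real n"
      using foc n(1) by (intro cover_entropy_le) (auto simp: finite_open_cover_def)
    moreover have "real (Suc ?b) \<le> real n * (h + e)"
    proof -
      have "real (Suc ?b) = real (M + 1) + real s * real (K * b)" by simp
      also have "\<dots> \<le> e' * real n + real s * (2 ^ d * (h + e'))"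
        using n(2) Kb by (intro add_mono mult_left_mono) auto
      also have "\<dots> = real n * (h + e)" by (simp add: n_def e'(2) algebra_simps)
      finally show ?thesis .
    qed
    then have "real (Suc ?b) / real n \<le> h + e" using n(1) by (simp add: divide_le_eq mult.commute)
    ultimately show ?thesis by simp
  qed
  then have "cover_entropy shuffle \<U> \<le> h" by (rule field_le_epsilon)
  then show "ereal (cover_entropy shuffle \<U>) \<le> ereal h" by simp
qed

end

section \<open>Computability of the shuffle\<close>

text \<open>
  Reading a code as a sequence lets the algorithm for the shuffle be the shuffle itself, applied
  to the decoded input; symbols beyond the end of the input do not influence the output asked for.
\<close>
definition decode :: "nat \<Rightarrow> nat \<Rightarrow> bool" where
  "decode w j \<longleftrightarrow> code_nth w j \<noteq> 0"

lemma decode_word_code: "j < n \<Longrightarrow> decode (word_code x n) j = x j"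
  by (simp add: decode_def word_code_def code_nth_list_encode del: upt.simps)

lemma rf_decode:
  "recursive_fun n a \<Longrightarrow> recursive_fun n b \<Longrightarrow> recursive_fun n (\<lambda>xs. of_bool (decode (a xs) (b xs)))"
  unfolding decode_def by (intro rf_intros rf_code_nth)

lemma rf_selector:
  "recursive_fun n a \<Longrightarrow> recursive_fun n b \<Longrightarrow> recursive_fun n (\<lambda>xs. of_bool (selector (decode (a xs)) (b xs)))"
  unfolding selector_def by (intro rf_intros rf_decode)

lemma rf_clock:
  "recursive_fun n a \<Longrightarrow> recursive_fun n b \<Longrightarrow> recursive_fun n (\<lambda>xs. of_bool (clock (decode (a xs)) (b xs)))"
  unfolding clock_def by (intro rf_intros rf_decode)

lemma rf_deck:
  "recursive_fun n a \<Longrightarrow> recursive_fun n b \<Longrightarrow> recursive_fun n (\<lambda>xs. of_bool (deck (decode (a xs)) (b xs)))"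
  unfolding deck_def by (intro rf_intros rf_decode)

lemma rf_leading_zeros:
  assumes "recursive_fun n a" "recursive_fun n b"
  shows "recursive_fun n (\<lambda>xs. leading_zeros (selector (decode (a xs))) (b xs))"
proof -
  have eq: "rec_nat 0 (\<lambda>n r. if r = n \<and> \<not> u n then Suc n else r) d = leading_zeros u d" for u d
    by (induction d) auto
  have "computable2 (\<lambda>w d. rec_nat 0 (\<lambda>n r. if r = n \<and> \<not> selector (decode w) n then Suc n else r) d)"
    unfolding computable2_def by (rule rf_rec) (intro rf_intros rf_selector; simp)+
  from rf_app2[OF this assms] show ?thesis unfolding eq .
qed

lemma rf_prefix_value:
  assumes "recursive_fun n a" "recursive_fun n b"
  shows "recursive_fun n (\<lambda>xs. prefix_value (clock (decode (a xs))) (b xs))"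
proof -
  have eq: "rec_nat 0 (\<lambda>n r. 2 * r + of_bool (c n)) d = prefix_value c d" for c d
    by (induction d) auto
  have "computable2 (\<lambda>w d. rec_nat 0 (\<lambda>n r. 2 * r + of_bool (clock (decode w) n)) d)"
    unfolding computable2_def by (rule rf_rec) (intro rf_intros rf_clock; simp)+
  from rf_app2[OF this assms] show ?thesis unfolding eq .
qed

lemma rf_odometer:
  assumes "recursive_fun n a" "recursive_fun n b"
  shows "recursive_fun n (\<lambda>xs. of_bool (odometer (clock (decode (a xs))) (b xs)))"
proof -
  have "computable2 (\<lambda>w k. of_bool (odometer (clock (decode w)) k))"
    unfolding computable2_def odometer_def
    by (intro rf_not rf_iff rf_all rf_clock; (intro rf_intros)?; simp)
  from rf_app2[OF this assms] show ?thesis .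
qed

context card_insertion
begin

lemma rf_active:
  assumes "computable3 (\<lambda>i d R. of_bool (G i d R))" "recursive_fun n a" "recursive_fun n b"
  shows "recursive_fun n
    (\<lambda>xs. of_bool (active (selector (decode (a xs))) (clock (decode (a xs))) (b xs)))"
  unfolding active_def
  by (intro rf_conj rf_le rf_app3[OF assms(1)] rf_leading_zeros rf_prefix_value rf_Suc assms)

lemma rf_source:
  assumes "computable3 (\<lambda>i d R. of_bool (G i d R))" "recursive_fun n a" "recursive_fun n b"
  shows "recursive_fun n (\<lambda>xs. source (selector (decode (a xs))) (clock (decode (a xs))) (b xs))"
  unfolding source_def
  by (intro rf_if rf_conj rf_less rf_active rf_leading_zeros rf_Suc rf_diff rf_const assms)

lemma computable_map_shuffle:
  assumes "computable3 (\<lambda>i d R. of_bool (G i d R))"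
  shows "computable_map shuffle"
proof -
  have "computable2 (\<lambda>w k. of_bool (shuffle (decode w) k))"
    unfolding computable2_def shuffle_def join_tracks_def
    by (intro rf_if_bool rf_eq rf_mod rf_div rf_const rf_selector rf_odometer rf_deck rf_add rf_mult
        rf_source assms recursive_fun.proj) (simp_all add: K_pos)
  then have A: "computable2 (\<lambda>n w. word_code (shuffle (decode w)) n)"
    by (rule computable2_encode_prefix)
  have \<phi>: "computable1 (\<lambda>n. n + 3 * K)"
    unfolding computable1_def by (intro rf_add rf_const recursive_fun.proj) simp
  have "word_code (shuffle (decode (word_code x (n + 3 * K)))) n = word_code (shuffle x) n" for x n
  proof -
    have "shuffle (decode (word_code x (n + 3 * K))) k = shuffle x k" if "k < n" for k
      using that by (intro shuffle_cong[of n] decode_word_code)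
    then show ?thesis unfolding word_code_def by (intro arg_cong[where f=list_encode] map_cong) auto
  qed
  moreover have "mono (\<lambda>n. n + 3 * K)" by (auto intro: monoI)
  ultimately show ?thesis unfolding computable_map_def using A \<phi> by blast
qed

end

section \<open>Prescribing the entropy\<close>

text \<open>
  The fraction \<open>R / 2 ^ d\<close> is compared with \<open>q i j / K\<close> for the \<open>j \<le> d\<close> known at depth \<open>d\<close>.  The
  clocks that pass all the comparisons have frequency \<open>Inf\<^sub>j q i j / K\<close>, cut off to the unit
  interval.
\<close>
definition below :: "(nat \<Rightarrow> nat \<Rightarrow> rat) \<Rightarrow> nat \<Rightarrow> nat \<Rightarrow> nat \<Rightarrow> nat \<Rightarrow> bool" where
  "below q K i d R \<longleftrightarrow> (\<forall>j\<le>d. real (K * R) < 2 ^ d * real_of_rat (q i j))"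

lemma card_insertion_below:
  assumes "K > 0"
  shows "card_insertion K (below q K)"
proof
  fix i d R assume below: "below q K i (Suc d) R"
  show "below q K i d (R div 2)"
    unfolding below_def
  proof (intro allI impI)
    fix j assume "j \<le> d"
    with below have "real (K * R) < 2 * (2 ^ d * real_of_rat (q i j))"
      by (simp add: below_def mult.assoc)
    moreover have "2 * real (K * (R div 2)) \<le> real (K * R)"
    proof -
      have "2 * (K * (R div 2)) \<le> K * R" by (simp add: mult.left_commute)
      then show ?thesis by (metis of_nat_le_iff of_nat_mult of_nat_numeral)
    qed
    ultimately show "real (K * (R div 2)) < 2 ^ d * real_of_rat (q i j)" by linarith
  qed
qed (rule assms)

text \<open>
  After clearing the denominator the comparison is one between natural numbers; it fails for a
  negative sign because the left-hand side is nonnegative.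
\<close>
lemma computable3_below:
  assumes "computable_rat_double_seq q"
  shows "computable3 (\<lambda>i d R. of_bool (below q K i d R))"
proof -
  from assms obtain s a b where sab: "computable2 s" "computable2 a" "computable2 b"
    "\<And>i j. b i j > 0" "\<And>i j. q i j = (- 1) ^ s i j * of_nat (a i j) / of_nat (b i j)"
    unfolding computable_rat_double_seq_def by blast
  have iff: "real (K * R) < 2 ^ d * real_of_rat (q i j) \<longleftrightarrow>
      s i j mod 2 = 0 \<and> K * R * b i j < 2 ^ d * a i j" for R d i j
  proof (cases "even (s i j)")
    case True
    then have "real_of_rat (q i j) = real (a i j) / real (b i j)"
      by (simp add: sab(5) of_rat_divide)
    then have "real (K * R) < 2 ^ d * real_of_rat (q i j) \<longleftrightarrow>
        real (K * R * b i j) < real (2 ^ d * a i j)"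
      using sab(4)[of i j] by (simp add: pos_less_divide_eq)
    with True show ?thesis unfolding of_nat_less_iff by (simp add: even_iff_mod_2_eq_zero)
  next
    case False
    then have "real_of_rat (q i j) = - (real (a i j) / real (b i j))"
      by (simp add: sab(5) of_rat_divide of_rat_minus)
    then have "2 ^ d * real_of_rat (q i j) \<le> 0" by (simp add: mult_nonneg_nonpos)
    also have "0 \<le> real (K * R)" by simp
    finally show ?thesis using False by (simp add: even_iff_mod_2_eq_zero)
  qed
  have "below q K i d R \<longleftrightarrow> (\<forall>j<Suc d. s i j mod 2 = 0 \<and> K * R * b i j < 2 ^ d * a i j)" for i d R
    unfolding below_def iff less_Suc_eq_le ..
  then show ?thesis
    unfolding computable3_def
    by (simp only:) (intro rf_all rf_conj rf_eq rf_less rf_mod rf_mult rf_power rf_const rf_Suc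
        rf_app2[OF sab(1)] rf_app2[OF sab(2)] rf_app2[OF sab(3)] rf_drop recursive_fun.proj; simp)
qed

theorem theoremB:
  fixes h :: real
  assumes "h > 0" and "Sigma2_computable h"
  shows "\<exists>f :: (nat \<Rightarrow> bool) \<Rightarrow> (nat \<Rightarrow> bool).
    surj f \<and> computable_map f \<and> topological_entropy f = ereal h"
proof -
  from assms(2) obtain q where q: "computable_rat_double_seq q"
    "ereal h = (SUP i. INF j. ereal (real_of_rat (q i j)))"
    unfolding Sigma2_computable_def by blast
  (* Every infimum is at most h, so with this K the cut-off at 1 loses nothing. *)
  define K where "K = nat \<lceil>h\<rceil>"
  have K: "K > 0" "h \<le> real K" using assms(1) by (auto simp: K_def)
  interpret card_insertion K "below q K" using card_insertion_below[OF K(1)] .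
  have "topological_entropy shuffle \<le> ereal h"
  proof (rule topological_entropy_shuffle_le)
    fix i and e :: real assume "e > 0"
    have "(INF j. ereal (real_of_rat (q i j))) \<le> ereal h" unfolding q(2) by (rule SUP_upper) simp
    also have "\<dots> < ereal (h + e / 2)" using \<open>e > 0\<close> by simp
    finally obtain j where j: "real_of_rat (q i j) < h + e / 2" by (auto simp: INF_less_iff)
    (* The bound on the count is off by one because of rounding, which contributes K to the product;
       at this depth that is at most half of the error e, relative to 2 ^ d. *)
    obtain d0 where d0: "real K / (e / 2) < 2 ^ d0" using real_arch_pow[of 2] by auto
    define d where "d = max j d0"
    have "(2 :: real) ^ d0 \<le> 2 ^ d" by (rule power_increasing) (simp_all add: d_def)
    with d0 have "real K / (e / 2) \<le> 2 ^ d" by linarith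
    then have Kd: "real K \<le> 2 ^ d * (e / 2)" using \<open>e > 0\<close> by (simp add: pos_divide_le_eq)
    let ?x = "2 ^ d * (h + e / 2) / real K"
    have x: "?x \<ge> 0" using \<open>e > 0\<close> assms(1) by simp
    have "R < nat \<lceil>?x\<rceil>" if "below q K i d R" for R
    proof -
      from that have "real K * real R < 2 ^ d * real_of_rat (q i j)" by (simp add: below_def d_def)
      also have "\<dots> \<le> 2 ^ d * (h + e / 2)" using j by (intro mult_left_mono) auto
      finally have "real R < ?x" using K(1) by (simp add: pos_less_divide_eq mult.commute)
      then show ?thesis by linarith
    qed
    then have "good i d \<le> card {..<nat \<lceil>?x\<rceil>}" unfolding good_def by (intro card_mono) auto
    then have "real (good i d) \<le> ?x + 1" using x by simp linarith
    then have "real K * real (good i d) \<le> real K * (?x + 1)" by (intro mult_left_mono) auto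
    also have "\<dots> = 2 ^ d * (h + e / 2) + real K" using K(1) by (simp add: distrib_left[of "real K"])
    also have "\<dots> \<le> 2 ^ d * (h + e)" using Kd by (simp add: algebra_simps)
    finally show "\<exists>d. real (K * good i d) \<le> 2 ^ d * (h + e)" by (intro exI[of _ d]) simp
  qed
  moreover have "ereal h \<le> topological_entropy shuffle"
  proof (rule dense_le)
    fix y' assume "y' < ereal h"
    show "y' \<le> topological_entropy shuffle"
    proof (cases y')
      case (real y)
      with \<open>y' < ereal h\<close> have "y < h" by simp
      from \<open>y' < ereal h\<close> obtain i where i: "ereal y < (INF j. ereal (real_of_rat (q i j)))"
        unfolding q(2) real by (auto simp: less_SUP_iff)
      have y: "y < real_of_rat (q i j)" for j
        using less_le_trans[OF i INF_lower[of j UNIV]] by simp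
      have "y * 2 ^ d \<le> real (K * good i d)" for d
      proof -
        let ?x = "2 ^ d * y / real K"
        have "below q K i d R \<and> R < 2 ^ d" if "R < nat \<lceil>?x\<rceil>" for R
        proof -
          from that have "real R < ?x" by linarith
          then have R: "real (K * R) < 2 ^ d * y" using K(1) by (simp add: pos_less_divide_eq mult.commute)
          have "2 ^ d * y \<le> 2 ^ d * real_of_rat (q i j)" for j
            using y[of j] by (intro mult_left_mono) auto
          with R have "below q K i d R" unfolding below_def by (meson less_le_trans)
          moreover have "2 ^ d * y \<le> 2 ^ d * real K" using \<open>y < h\<close> K(2) by (intro mult_left_mono) auto
          with R have "real (K * R) < 2 ^ d * real K" by (rule less_le_trans)
          then have "real R < 2 ^ d" using K(1) by simp
          then have "R < 2 ^ d" by (metis of_nat_less_iff of_nat_numeral of_nat_power)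
          ultimately show ?thesis by blast
        qed
        then have "card {..<nat \<lceil>?x\<rceil>} \<le> good i d" unfolding good_def by (intro card_mono) auto
        then have "?x \<le> real (good i d)" by simp
        then have "2 ^ d * y \<le> real (good i d) * real K" using K(1) by (simp add: pos_divide_le_eq)
        then show ?thesis by (simp add: mult.commute)
      qed
      then show ?thesis unfolding real by (rule le_topological_entropy_shuffle)
    qed (use \<open>y' < ereal h\<close> in auto)
  qed
  ultimately have "topological_entropy shuffle = ereal h" by (rule antisym)
  moreover have "computable_map shuffle" by (intro computable_map_shuffle computable3_below q(1))
  ultimately show ?thesis using surj_shuffle by blast
qed

end
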